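(* Let $\mathcal{N}$ be a minimal irreducible sorting network. Then the simplicial complex $\Delta(\mathcal{N})$ is (isomorphic to) the boundary complex of the polar of the brick polytope $\Omega(\mathcal{N})$. In particular, the graph of $\Omega(\mathcal{N})$ is the flip graph $G(\mathcal{N})$.
   Context: A network $\mathcal{N}$ with $n$ levels and $m$ commutators consists of $n$ horizontal lines (levels), labeled $1,\dots,n$ from bottom to top, together with $m$ vertical segments (commutators), each joining two consecutive levels, such that no two commutators share an endpoint. The bricks are its bounded cells. A pseudoline is an abscissa-monotone path in $\mathcal{N}$. A contact between two pseudolines is a commutator whose two endpoints lie one on each pseudoline; a crossing is a commutator traversed by both. A pseudoline arrangement supported by $\mathcal{N}$ is a set of $n$ pseudolines such that any two have exactly one crossing, possibly some contacts, and no other intersection; its $i$-th pseudoline starts at level $i$ on the left. $\mathcal{N}$ is sorting if it supports at least one arrangement; $\mathrm{arr}(\mathcal{N})$ is the set of these; an arrangement is determined by its set of contacts. Flip: if $V$ is the set of contacts of $\Lambda$ and $v\in V$ is a contact between two pseudolines crossing at the commutator $w$, then $(V\setminus\{v\})\cup\{w\}$ is the set of contacts of another arrangement; the flip graph $G(\mathcal{N})$ has vertex set $\mathrm{arr}(\mathcal{N})$ and an edge for each flip. $\Delta(\mathcal{N})$ is the simplicial complex of all sets of commutators contained in the set of contacts of some $\Lambda\in\mathrm{arr}(\mathcal{N})$. The brick vector $\omega(\Lambda)\in\mathbb{R}^n$ has $i$-th coordinate the number of bricks below the $i$-th pseudoline; $\Omega(\mathcal{N})$ is the convex hull of all brick vectors.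 The contact graph of $\Lambda$ is the directed multigraph on $[n]$ with one arc per contact, oriented from the pseudoline passing above the contact to the one below. $\mathcal{N}$ is irreducible if these contact graphs are connected (as undirected graphs); an irreducible sorting network is minimal if it has $m=\binom{n}{2}+n-1$ commutators (equivalently, the contact graphs of the arrangements it supports are trees). *)

theory Defs
  imports "Graph_Theory.Digraph_Component" "HOL-Analysis.Analysis"
begin

section \<open>Networks and pseudoline arrangements\<close>

text \<open>
  The levels of a network are the elements of a finite linearly ordered type \<open>'n\<close>, from bottom
  to top, so \<open>n = CARD('n)\<close>. As no two commutators share an endpoint, commutators can be moved
  slightly to have distinct abscissae, and a network is given by the list of its commutators from
  left to right, each being the pair of its lower and its upper level. A commutator is referred to
  by its position in this list.
\<close>

type_synonym 'n network = "('n \<times> 'n) list"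

definition network :: "'n::{finite,linorder} network \<Rightarrow> bool" where
  "network N \<longleftrightarrow> (\<forall>(a, b) \<in> set N. a < b \<and> \<not> (\<exists>d. a < d \<and> d < b))"

text \<open>
  An abscissa-monotone path is the list \<open>p\<close> of its successive levels: \<open>p ! 0\<close> is its level at the
  left end, and \<open>p ! k\<close> and \<open>p ! (k + 1)\<close> are its levels just before and just after the
  abscissa of commutator \<open>k\<close>.
\<close>

definition pseudoline :: "'n::{finite,linorder} network \<Rightarrow> 'n list \<Rightarrow> bool" where
  "pseudoline N p \<longleftrightarrow> length p = length N + 1 \<and>
     (\<forall>k < length N. p ! (k + 1) = p ! k \<or>
        {p ! k, p ! (k + 1)} = {fst (N ! k), snd (N ! k)})"

definition traverses :: "'n list \<Rightarrow> nat \<Rightarrow> bool" where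
  "traverses p k \<longleftrightarrow> p ! k \<noteq> p ! (k + 1)"

definition crossing :: "'n::{finite,linorder} network \<Rightarrow> 'n list \<Rightarrow> 'n list \<Rightarrow> nat \<Rightarrow> bool" where
  "crossing N p q k \<longleftrightarrow> k < length N \<and> traverses p k \<and> traverses q k"

definition contact :: "'n::{finite,linorder} network \<Rightarrow> 'n list \<Rightarrow> 'n list \<Rightarrow> nat \<Rightarrow> bool" where
  "contact N p q k \<longleftrightarrow> k < length N \<and> \<not> traverses p k \<and> \<not> traverses q k \<and>
     {p ! k, q ! k} = {fst (N ! k), snd (N ! k)}"

text \<open>
  \<open>\<Lambda> i\<close> is the pseudoline starting at level \<open>i\<close>. The pseudolines of an arrangement start at
  distinct levels, so indexing them in this way is no restriction. Two pseudolines intersect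
  elsewhere than at a common crossing exactly if they share a level between two successive
  commutators.
\<close>

definition arr :: "'n::{finite,linorder} network \<Rightarrow> ('n \<Rightarrow> 'n list) set" where
  "arr N = {\<Lambda>. (\<forall>i. pseudoline N (\<Lambda> i) \<and> \<Lambda> i ! 0 = i) \<and>
     (\<forall>i j. i \<noteq> j \<longrightarrow> (\<exists>!k. crossing N (\<Lambda> i) (\<Lambda> j) k) \<and>
        (\<forall>k \<le> length N. \<Lambda> i ! k \<noteq> \<Lambda> j ! k))}"

definition contacts :: "'n::{finite,linorder} network \<Rightarrow> ('n \<Rightarrow> 'n list) \<Rightarrow> nat set" where
  "contacts N \<Lambda> = {k. \<exists>i j. i \<noteq> j \<and> contact N (\<Lambda> i) (\<Lambda> j) k}"

definition sorting :: "'n::{finite,linorder} network \<Rightarrow> bool" where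
  "sorting N \<longleftrightarrow> network N \<and> arr N \<noteq> {}"

definition contact_graph ::
  "'n::{finite,linorder} network \<Rightarrow> ('n \<Rightarrow> 'n list) \<Rightarrow> ('n, nat) pre_digraph" where
  "contact_graph N \<Lambda> = \<lparr> verts = UNIV, arcs = contacts N \<Lambda>,
     tail = (\<lambda>k. THE i. \<Lambda> i ! k = snd (N ! k)),
     head = (\<lambda>k. THE i. \<Lambda> i ! k = fst (N ! k)) \<rparr>"

definition irreducible_network :: "'n::{finite,linorder} network \<Rightarrow> bool" where
  "irreducible_network N \<longleftrightarrow> (\<forall>\<Lambda> \<in> arr N. Digraph_Component.connected (contact_graph N \<Lambda>))"

definition minimal_irreducible_sorting :: "'n::{finite,linorder} network \<Rightarrow> bool" where
  "minimal_irreducible_sorting N \<longleftrightarrow> sorting N \<and> irreducible_network N \<and>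
     length N = (CARD('n) choose 2) + CARD('n) - 1"

definition network_complex :: "'n::{finite,linorder} network \<Rightarrow> nat set set" where
  "network_complex N = {S. \<exists>\<Lambda> \<in> arr N. S \<subseteq> contacts N \<Lambda>}"


section \<open>Graphs\<close>

text \<open>Simple undirected graphs, given by their vertices and their two-element edges.\<close>

type_synonym 'v ugraph = "'v set \<times> 'v set set"

definition ugraph_iso :: "('v \<Rightarrow> 'w) \<Rightarrow> 'v ugraph \<Rightarrow> 'w ugraph \<Rightarrow> bool" where
  "ugraph_iso f G H \<longleftrightarrow> bij_betw f (fst G) (fst H) \<and> (image f) ` snd G = snd H"

definition flip :: "'n::{finite,linorder} network \<Rightarrow> ('n \<Rightarrow> 'n list) \<Rightarrow> ('n \<Rightarrow> 'n list) \<Rightarrow> bool" where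
  "flip N \<Lambda> \<Lambda>' \<longleftrightarrow> (\<exists>i j v w. i \<noteq> j \<and> contact N (\<Lambda> i) (\<Lambda> j) v \<and>
     crossing N (\<Lambda> i) (\<Lambda> j) w \<and> contacts N \<Lambda>' = (contacts N \<Lambda> - {v}) \<union> {w})"

definition flip_graph :: "'n::{finite,linorder} network \<Rightarrow> ('n \<Rightarrow> 'n list) ugraph" where
  "flip_graph N = (arr N, {{\<Lambda>, \<Lambda>'} | \<Lambda> \<Lambda>'. \<Lambda> \<in> arr N \<and> \<Lambda>' \<in> arr N \<and> flip N \<Lambda> \<Lambda>'})"

definition polytope_graph :: "'a::euclidean_space set \<Rightarrow> 'a ugraph" where
  "polytope_graph P = ({x. x extreme_point_of P}, {{x, y} | x y. closed_segment x y edge_of P})"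


section \<open>The brick polytope\<close>

text \<open>A bounded cell is the region between two successive commutators joining the same two levels.\<close>

definition bricks :: "'n::{finite,linorder} network \<Rightarrow> (nat \<times> nat) set" where
  "bricks N = {(j, k). j < k \<and> k < length N \<and> N ! j = N ! k \<and>
     (\<forall>t. j < t \<and> t < k \<longrightarrow> N ! t \<noteq> N ! j)}"

definition brick_below :: "'n::{finite,linorder} network \<Rightarrow> 'n list \<Rightarrow> nat \<times> nat \<Rightarrow> bool" where
  "brick_below N p = (\<lambda>(j, k). \<forall>t \<in> {j<..k}. snd (N ! j) \<le> p ! t)"

definition brick_vector :: "'n::{finite,linorder} network \<Rightarrow> ('n \<Rightarrow> 'n list) \<Rightarrow> real ^ ('n::{finite,linorder})" where
  "brick_vector N \<Lambda> = (\<chi> i. real (card {B \<in> bricks N. brick_below N (\<Lambda> i) B}))"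

definition brick_polytope :: "'n::{finite,linorder} network \<Rightarrow> (real ^ ('n::{finite,linorder})) set" where
  "brick_polytope N = convex hull (brick_vector N ` arr N)"


section \<open>Polars and boundary complexes\<close>

text \<open>
  The polar of a polytope that need not be full-dimensional, taken inside the affine span of \<open>P\<close>
  with a relative interior point \<open>z\<close> of \<open>P\<close> as origin.
\<close>

definition polar_about :: "'a::euclidean_space \<Rightarrow> 'a set \<Rightarrow> 'a set" where
  "polar_about z P = {y \<in> span ((\<lambda>x. x - z) ` P). \<forall>x \<in> P. inner y (x - z) \<le> 1}"

text \<open>The proper faces, including the empty one.\<close>

definition boundary_complex :: "'a::euclidean_space set \<Rightarrow> 'a set set" where
  "boundary_complex Q = {F. F face_of Q \<and> F \<noteq> Q}"

definition vertex_scheme :: "'a::euclidean_space set set \<Rightarrow> 'a set set" where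
  "vertex_scheme \<C> = (\<lambda>F. {x. x extreme_point_of F}) ` \<C>"

definition simplicially_isomorphic :: "'a set set \<Rightarrow> 'b set set \<Rightarrow> bool" where
  "simplicially_isomorphic K L \<longleftrightarrow>
     (\<exists>f. bij_betw f (\<Union>K) (\<Union>L) \<and> (\<forall>S. S \<subseteq> \<Union>K \<longrightarrow> (S \<in> K \<longleftrightarrow> f ` S \<in> L)))"

end

theory Submission
  imports Defs
begin

text \<open>
  The contact graph of an arrangement is a tree, so its arcs \<open>e\<^sub>h - e\<^sub>t\<close> form a basis of the
  hyperplane \<open>W\<close> of vectors with coordinate sum zero, and a flip moves the brick vector by a positive
  multiple of the arc of the flipped contact. For every injective \<open>c\<close> there is at most one arrangement
  all of whose contact arcs increase \<open>c\<close>: for the natural order of the lines such an arrangement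
  is found by sweeping from left to right, and if \<open>c\<close> is changed by exchanging two consecutive values
  \<open>c i\<close>, \<open>c j\<close>, then flipping the contact between \<open>i\<close> and \<open>j\<close>, if there is one, is a bijection between
  the arrangements sorted by the old and by the new \<open>c\<close>. Hence a local minimum of a linear functional
  under flips is a global one, and the cones dual to the contact trees form a complete simplicial fan,
  the normal fan of the brick polytope. Its rays correspond to the commutators in the ground set of
  the complex, and scaled to height 1 they are the vertices of the polar.
\<close>

section \<open>Flip systems\<close>

text \<open>Two obstacles shape the proof. First, a flip does more than reverse one arc: a contact
  between the old and the new one may have its ends transposed. But a functional orthogonal to the
  flipped arc has equal coordinates at the two lines and does not notice the transposition, so its
  values on the kept contacts survive every flip orthogonal to it. This is why a facet normal
  depends on its commutator alone and why a functional is constant on the star of its support.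
  Second, the sweep settles uniqueness only for \<open>c\<close> increasing along the lines, because
  they start in that order; any other \<open>c\<close> is reached by bubble sort, one wall
  \<open>c i = c j\<close> at a time. Here the tree condition enters: at most one contact joins
  \<open>i\<close> and \<open>j\<close>, so passing a wall reverses at most one arc. A local minimum
  is then compared with a global one: a common tie-breaking \<open>c\<close> forces equal supports,
  and on the star of the support the values are equal. The length of the step in a flip is the
  number of bricks handed from one line to the other.\<close>

text \<open>Every third value lies outside the gap from \<open>c j\<close> to \<open>c i\<close>, so
  it compares alike with both ends. The lemma serves twice: for exchanging two lines in an order
  \<open>c\<close> and, with \<open>c = id\<close>, for exchanging the two levels of a
  commutator.\<close>

lemma adjacent_transpose_less:
  fixes c :: "'a \<Rightarrow> 'b::linorder"
  assumes "inj c" "c j < c i" "\<And>k. \<not> (c j < c k \<and> c k < c i)" "{p, q} \<noteq> {i, j}"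
  shows "c (Transposition.transpose i j p) < c (Transposition.transpose i j q) \<longleftrightarrow> c p < c q"
proof -
  have out: "c k < c j \<or> c i < c k" if "k \<noteq> i" "k \<noteq> j" for k
    using assms(3)[of k] that injD[OF assms(1), of k i] injD[OF assms(1), of k j] by force
  consider "p = q" | "p = i" "q \<noteq> i" "q \<noteq> j" | "p = j" "q \<noteq> i" "q \<noteq> j"
    | "p \<noteq> i" "p \<noteq> j" "q = i" | "p \<noteq> i" "p \<noteq> j" "q = j" | "p \<noteq> i" "p \<noteq> j" "q \<noteq> i" "q \<noteq> j"
    using assms(4) by blast
  then show ?thesis
  proof cases
    case 2 then show ?thesis using out[of q] assms(2) by auto
  next
    case 3 then show ?thesis using out[of q] assms(2) by auto
  next
    case 4 then show ?thesis using out[of p] assms(2) by auto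
  next
    case 5 then show ?thesis using out[of p] assms(2) by auto
  qed simp_all
qed

text \<open>An inversion of least gap has no value inside it: for a line \<open>k\<close> with a
  value inside, \<open>(k, j)\<close> or \<open>(i, k)\<close> would be a narrower
  inversion.\<close>

lemma obtain_adjacent_inversion:
  fixes c :: "'n::{finite,linorder} \<Rightarrow> real"
  assumes "inj c" "\<not> strict_mono c"
  obtains i j where "i < j" "c j < c i" "\<And>k. \<not> (c j < c k \<and> c k < c i)"
proof -
  define I where "I = {(i, j). i < j \<and> c j < c i}"
  have "I \<noteq> {}"
    using assms by (auto simp: I_def strict_mono_def not_less order_le_less dest: injD)
  then obtain p where "is_arg_min (\<lambda>q. c (fst q) - c (snd q)) (\<lambda>q. q \<in> I) p"
    using ex_is_arg_min_if_finite[of I "\<lambda>q. c (fst q) - c (snd q)"] by auto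
  then have "p \<in> I" and min: "\<And>q. q \<in> I \<Longrightarrow> c (fst p) - c (snd p) \<le> c (fst q) - c (snd q)"
    by (auto simp: is_arg_min_linorder)
  then obtain i j where ij: "p = (i, j)" "i < j" "c j < c i" by (auto simp: I_def)
  have "\<not> (c j < c k \<and> c k < c i)" for k
  proof
    assume k: "c j < c k \<and> c k < c i"
    have "k < j \<or> k > i" using ij by auto
    then have "(k, j) \<in> I \<or> (i, k) \<in> I" using k by (auto simp: I_def)
    then show False using min[of "(k, j)"] min[of "(i, k)"] k ij by auto
  qed
  then show thesis using that ij by blast
qed

text \<open>
  What the geometry needs of the arrangements \<open>A\<close> with contact sets \<open>V\<close>: \<open>upper \<Lambda> v\<close> and
  \<open>lower \<Lambda> v\<close> are the lines passing above and below the contact \<open>v\<close>, and \<open>X \<Lambda> i j\<close> is the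
  commutator where \<open>i\<close> and \<open>j\<close> cross, which makes a flip reversible. Exchanging \<open>i\<close> and \<open>j\<close>
  between the two commutators of a flip transposes the ends of the contacts lying in between.
  Fixing a set \<open>S\<close> of contacts in \<open>sorted_unique\<close> amounts to deleting these commutators
  from the network.
\<close>

locale flip_system =
  fixes A :: "'a set" and V :: "'a \<Rightarrow> 'v set"
    and upper lower :: "'a \<Rightarrow> 'v \<Rightarrow> 'n::{finite,linorder}"
    and X :: "'a \<Rightarrow> 'n \<Rightarrow> 'n \<Rightarrow> 'v"
    and \<omega> :: "'a \<Rightarrow> (real, 'n) vec"
  assumes finite_A: "finite A" and A_nonempty: "A \<noteq> {}"
    and inj_V: "inj_on V A"
    and finite_V: "\<Lambda> \<in> A \<Longrightarrow> finite (V \<Lambda>)"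
    and card_V: "\<Lambda> \<in> A \<Longrightarrow> card (V \<Lambda>) = CARD('n) - 1"
    and spanning: "\<Lambda> \<in> A \<Longrightarrow> {x :: (real, 'n) vec. (\<Sum>i\<in>UNIV. x $ i) = 0}
      \<subseteq> span ((\<lambda>v. axis (lower \<Lambda> v) 1 - axis (upper \<Lambda> v) 1) ` V \<Lambda>)"
    and flip_ex: "\<Lambda> \<in> A \<Longrightarrow> v \<in> V \<Lambda> \<Longrightarrow>
      \<exists>\<Lambda>'\<in>A. \<exists>w l. w \<notin> V \<Lambda> \<and> V \<Lambda>' = insert w (V \<Lambda> - {v}) \<and>
        upper \<Lambda>' w = lower \<Lambda> v \<and> lower \<Lambda>' w = upper \<Lambda> v \<and>
        X \<Lambda>' (upper \<Lambda> v) (lower \<Lambda> v) = v \<and>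
        (\<forall>u\<in>V \<Lambda> - {v}. upper \<Lambda>' u = upper \<Lambda> u \<and> lower \<Lambda>' u = lower \<Lambda> u \<or>
           upper \<Lambda>' u = Transposition.transpose (upper \<Lambda> v) (lower \<Lambda> v) (upper \<Lambda> u) \<and>
           lower \<Lambda>' u = Transposition.transpose (upper \<Lambda> v) (lower \<Lambda> v) (lower \<Lambda> u)) \<and>
        0 < l \<and> \<omega> \<Lambda>' = \<omega> \<Lambda> + l *\<^sub>R (axis (lower \<Lambda> v) 1 - axis (upper \<Lambda> v) 1)"
    and sorted_unique: "\<Lambda>1 \<in> A \<Longrightarrow> \<Lambda>2 \<in> A \<Longrightarrow> S \<subseteq> V \<Lambda>1 \<Longrightarrow> S \<subseteq> V \<Lambda>2 \<Longrightarrow>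
      (\<And>v. v \<in> V \<Lambda>1 - S \<Longrightarrow> upper \<Lambda>1 v < lower \<Lambda>1 v) \<Longrightarrow>
      (\<And>v. v \<in> V \<Lambda>2 - S \<Longrightarrow> upper \<Lambda>2 v < lower \<Lambda>2 v) \<Longrightarrow> \<Lambda>1 = \<Lambda>2"
begin

section \<open>Arc vectors as bases of the sum-zero hyperplane\<close>

definition W :: "((real, 'n) vec) set" where
  "W = {x. (\<Sum>i\<in>UNIV. x $ i) = 0}"

definition arc_vec :: "'a \<Rightarrow> 'v \<Rightarrow> (real, 'n) vec" where
  "arc_vec \<Lambda> v = axis (lower \<Lambda> v) 1 - axis (upper \<Lambda> v) 1"

lemma inner_arc: "x \<bullet> arc_vec \<Lambda> v = x $ lower \<Lambda> v - x $ upper \<Lambda> v"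
  by (simp add: arc_vec_def inner_diff_right inner_axis)

lemma W_eq_hyperplane: "W = {x. (\<chi> i. 1) \<bullet> x = 0}"
  by (simp add: W_def inner_vec_def)

lemma subspace_W: "subspace W"
  unfolding W_eq_hyperplane by (rule subspace_hyperplane)

lemma arc_in_W: "arc_vec \<Lambda> v \<in> W"
  by (simp add: W_eq_hyperplane inner_arc)

lemma dim_W: "dim W = CARD('n) - 1"
proof -
  have "(\<chi> i. 1) \<noteq> (0 :: (real, 'n) vec)" by (simp add: vec_eq_iff)
  then show ?thesis unfolding W_eq_hyperplane by (subst dim_hyperplane) auto
qed

lemma span_arcs: assumes "\<Lambda> \<in> A" shows "span (arc_vec \<Lambda> ` V \<Lambda>) = W"
proof
  show "span (arc_vec \<Lambda> ` V \<Lambda>) \<subseteq> W"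
    by (rule span_minimal) (auto simp: arc_in_W subspace_W)
  show "W \<subseteq> span (arc_vec \<Lambda> ` V \<Lambda>)"
    using spanning[OF assms] by (simp add: W_def arc_vec_def[abs_def])
qed

text \<open>Dimension count: \<open>W\<close> has dimension n - 1 and is spanned by the arcs of n -
  1 contacts, so no two contacts give the same vector. With \<open>independent_arcs\<close> this is
  the linear form of the contact graph being a tree.\<close>

lemma inj_on_arc: assumes "\<Lambda> \<in> A" shows "inj_on (arc_vec \<Lambda>) (V \<Lambda>)"
proof -
  have "dim W \<le> card (arc_vec \<Lambda> ` V \<Lambda>)"
    using span_arcs[OF assms] dim_le_card[of W "arc_vec \<Lambda> ` V \<Lambda>"] finite_V[OF assms] by auto
  moreover have "card (arc_vec \<Lambda> ` V \<Lambda>) \<le> card (V \<Lambda>)"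
    using finite_V[OF assms] by (rule card_image_le)
  ultimately show ?thesis
    using card_V[OF assms] dim_W finite_V[OF assms] by (intro eq_card_imp_inj_on) auto
qed

lemma independent_arcs: assumes "\<Lambda> \<in> A" shows "independent (arc_vec \<Lambda> ` V \<Lambda>)"
proof (rule card_le_dim_spanning[where V = W])
  show "card (arc_vec \<Lambda> ` V \<Lambda>) \<le> dim W"
    using card_V[OF assms] dim_W card_image[OF inj_on_arc[OF assms]] by simp
  show "arc_vec \<Lambda> ` V \<Lambda> \<subseteq> W" by (auto simp: arc_in_W)
  show "W \<subseteq> span (arc_vec \<Lambda> ` V \<Lambda>)" by (simp add: span_arcs[OF assms])
  show "finite (arc_vec \<Lambda> ` V \<Lambda>)" using finite_V[OF assms] by simp
qed

lemma upper_neq_lower: assumes "\<Lambda> \<in> A" "v \<in> V \<Lambda>" shows "upper \<Lambda> v \<noteq> lower \<Lambda> v"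
proof
  assume "upper \<Lambda> v = lower \<Lambda> v"
  then have "arc_vec \<Lambda> v = 0" by (simp add: arc_vec_def)
  then show False using independent_arcs[OF assms(1)] assms(2) dependent_zero by (metis image_eqI)
qed

text \<open>Parallel arcs, and opposite ones in \<open>no_antiparallel_arcs\<close>, would be
  linearly dependent, so at most one contact joins two given lines. Hence at most one arc is
  reversed when a wall is passed.\<close>

lemma no_parallel_arcs:
  assumes "\<Lambda> \<in> A" "v \<in> V \<Lambda>" "u \<in> V \<Lambda>" "upper \<Lambda> v = upper \<Lambda> u" "lower \<Lambda> v = lower \<Lambda> u"
  shows "v = u"
  using assms inj_onD[OF inj_on_arc[OF assms(1)], of v u] by (simp add: arc_vec_def)

lemma no_antiparallel_arcs:
  assumes "\<Lambda> \<in> A" "v \<in> V \<Lambda>" "u \<in> V \<Lambda>" "upper \<Lambda> v = lower \<Lambda> u"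
  shows "lower \<Lambda> v \<noteq> upper \<Lambda> u"
proof
  assume *: "lower \<Lambda> v = upper \<Lambda> u"
  have neg: "arc_vec \<Lambda> v = - arc_vec \<Lambda> u" by (simp add: arc_vec_def assms(4) *)
  have "arc_vec \<Lambda> v \<noteq> arc_vec \<Lambda> u"
  proof
    assume "arc_vec \<Lambda> v = arc_vec \<Lambda> u"
    then have "arc_vec \<Lambda> u = 0" using neg by (simp add: vec_eq_iff)
    then show False using independent_arcs[OF assms(1)] assms(3) dependent_zero by (metis image_eqI)
  qed
  then have "arc_vec \<Lambda> u \<in> arc_vec \<Lambda> ` V \<Lambda> - {arc_vec \<Lambda> v}" using assms(3) by simp
  then have "arc_vec \<Lambda> v \<in> span (arc_vec \<Lambda> ` V \<Lambda> - {arc_vec \<Lambda> v})"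
    using neg span_neg[OF span_base] by metis
  then show False
    using independent_arcs[OF assms(1)] assms(2) by (auto simp: dependent_def)
qed

section \<open>Flips and stars\<close>

definition flips :: "'a \<Rightarrow> 'v \<Rightarrow> 'a \<Rightarrow> bool" where
  "flips \<Lambda> v \<Lambda>' \<longleftrightarrow> (\<exists>w l. w \<notin> V \<Lambda> \<and> V \<Lambda>' = insert w (V \<Lambda> - {v}) \<and>
     upper \<Lambda>' w = lower \<Lambda> v \<and> lower \<Lambda>' w = upper \<Lambda> v \<and>
     X \<Lambda>' (upper \<Lambda> v) (lower \<Lambda> v) = v \<and>
     (\<forall>u\<in>V \<Lambda> - {v}. upper \<Lambda>' u = upper \<Lambda> u \<and> lower \<Lambda>' u = lower \<Lambda> u \<or>
        upper \<Lambda>' u = Transposition.transpose (upper \<Lambda> v) (lower \<Lambda> v) (upper \<Lambda> u) \<and>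
        lower \<Lambda>' u = Transposition.transpose (upper \<Lambda> v) (lower \<Lambda> v) (lower \<Lambda> u)) \<and>
     0 < l \<and> \<omega> \<Lambda>' = \<omega> \<Lambda> + l *\<^sub>R arc_vec \<Lambda> v)"

lemma flip_exists:
  assumes "\<Lambda> \<in> A" "v \<in> V \<Lambda>" obtains \<Lambda>' where "\<Lambda>' \<in> A" "flips \<Lambda> v \<Lambda>'"
  using flip_ex[OF assms] unfolding flips_def arc_vec_def by blast

text \<open>Descent: a functional strictly increasing in the lines attains its minimum on the finite
  set \<open>B\<close>. An unsorted contact outside \<open>S\<close> could be flipped within
  \<open>B\<close> along an arc on which the functional is negative.\<close>

lemma exists_sorted:
  assumes "B \<subseteq> A" "B \<noteq> {}"
    and closed: "\<And>\<Lambda> v \<Lambda>'. \<Lambda> \<in> B \<Longrightarrow> v \<in> V \<Lambda> - S \<Longrightarrow> \<Lambda>' \<in> A \<Longrightarrow> flips \<Lambda> v \<Lambda>' \<Longrightarrow> \<Lambda>' \<in> B"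
  obtains \<Lambda> where "\<Lambda> \<in> B" "\<And>v. v \<in> V \<Lambda> - S \<Longrightarrow> upper \<Lambda> v < lower \<Lambda> v"
proof -
  \<comment> \<open>The ranks of the lines turn their order into a strictly increasing real
    vector.\<close>
  define r :: "(real, 'n) vec" where "r = (\<chi> i. real (card {k. k < i}))"
  have r_mono: "r $ i < r $ j" if "i < j" for i j
    using that by (auto simp: r_def intro!: psubset_card_mono)
  have "finite B" using assms(1) finite_A finite_subset by blast
  then obtain \<Lambda> where \<Lambda>: "\<Lambda> \<in> B" and min: "\<And>M. M \<in> B \<Longrightarrow> r \<bullet> \<omega> \<Lambda> \<le> r \<bullet> \<omega> M"
    using assms(2) ex_is_arg_min_if_finite[of B "\<lambda>M. r \<bullet> \<omega> M"]
    by (auto simp: is_arg_min_linorder)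
  have "upper \<Lambda> v < lower \<Lambda> v" if v: "v \<in> V \<Lambda> - S" for v
  proof -
    have "\<Lambda> \<in> A" using \<Lambda> assms(1) by auto
    obtain \<Lambda>' where \<Lambda>': "\<Lambda>' \<in> A" "flips \<Lambda> v \<Lambda>'" using flip_exists[OF \<open>\<Lambda> \<in> A\<close>, of v] v by blast
    then obtain l where l: "0 < l" "\<omega> \<Lambda>' = \<omega> \<Lambda> + l *\<^sub>R arc_vec \<Lambda> v" by (auto simp: flips_def)
    have "r \<bullet> \<omega> \<Lambda> \<le> r \<bullet> \<omega> \<Lambda>'" using closed[OF \<Lambda> v \<Lambda>'] min by blast
    then have "0 \<le> r $ lower \<Lambda> v - r $ upper \<Lambda> v"
      using l by (simp add: inner_add_right inner_arc zero_le_mult_iff)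
    then show ?thesis
      using r_mono[of "lower \<Lambda> v" "upper \<Lambda> v"] upper_neq_lower[OF \<open>\<Lambda> \<in> A\<close>, of v] v by force
  qed
  then show thesis using that \<Lambda> by blast
qed

lemma flipsE:
  assumes "flips \<Lambda> v \<Lambda>'"
  obtains w where "w \<notin> V \<Lambda>" "V \<Lambda>' = insert w (V \<Lambda> - {v})"
    "upper \<Lambda>' w = lower \<Lambda> v" "lower \<Lambda>' w = upper \<Lambda> v"
    "X \<Lambda>' (upper \<Lambda> v) (lower \<Lambda> v) = v"
  using assms unfolding flips_def by blast

lemma flips_keep: "flips \<Lambda> v \<Lambda>' \<Longrightarrow> S \<subseteq> V \<Lambda> \<Longrightarrow> v \<notin> S \<Longrightarrow> S \<subseteq> V \<Lambda>'"
  by (auto simp: flips_def)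

text \<open>
  Descending from any arrangement by flips that keep \<open>S\<close> ends at the unique arrangement sorted
  outside \<open>S\<close>, so these flips connect the star of \<open>S\<close>.
\<close>

lemma star_induct:
  assumes "\<Lambda> \<in> A" "\<Lambda>' \<in> A" "S \<subseteq> V \<Lambda>" "S \<subseteq> V \<Lambda>'" "P \<Lambda>"
    and step: "\<And>\<Lambda>1 v \<Lambda>2. \<Lambda>1 \<in> A \<Longrightarrow> \<Lambda>2 \<in> A \<Longrightarrow> S \<subseteq> V \<Lambda>1 \<Longrightarrow> v \<in> V \<Lambda>1 - S \<Longrightarrow>
      flips \<Lambda>1 v \<Lambda>2 \<Longrightarrow> P \<Lambda>1 \<longleftrightarrow> P \<Lambda>2"
  shows "P \<Lambda>'"
proof (rule ccontr)
  assume "\<not> P \<Lambda>'"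
  define B where "B b = {M \<in> A. S \<subseteq> V M \<and> P M = b}" for b
  have "\<exists>M\<in>B b. \<forall>v\<in>V M - S. upper M v < lower M v" for b
  proof -
    have "B b \<noteq> {}"
    proof (cases b)
      case True
      then have "\<Lambda> \<in> B b" using assms(1,3,5) unfolding B_def by blast
      then show ?thesis by blast
    next
      case False
      then have "\<Lambda>' \<in> B b" using assms(2,4) \<open>\<not> P \<Lambda>'\<close> unfolding B_def by blast
      then show ?thesis by blast
    qed
    moreover have "M' \<in> B b" if M: "M \<in> B b" "v \<in> V M - S" "M' \<in> A" "flips M v M'" for M v M'
    proof -
      have "S \<subseteq> V M'" using M flips_keep unfolding B_def by blast
      moreover have "P M \<longleftrightarrow> P M'" using M step unfolding B_def by blast
      ultimately show ?thesis using M unfolding B_def by blast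
    qed
    moreover have "B b \<subseteq> A" unfolding B_def by blast
    ultimately obtain M where "M \<in> B b" "\<And>v. v \<in> V M - S \<Longrightarrow> upper M v < lower M v"
      using exists_sorted[of "B b" S] by metis
    then show ?thesis by blast
  qed
  then obtain M1 M2 where "M1 \<in> B True" "M2 \<in> B False"
    "\<forall>v\<in>V M1 - S. upper M1 v < lower M1 v" "\<forall>v\<in>V M2 - S. upper M2 v < lower M2 v" by meson
  then show False using sorted_unique[of M1 M2 S] by (auto simp: B_def)
qed

text \<open>Orthogonality to the flipped arc means equal coordinates at its two lines, so
  transposing these in the ends of another arc changes no value.\<close>

lemma flips_inner_arc:
  assumes "flips \<Lambda> v \<Lambda>'" "x \<bullet> arc_vec \<Lambda> v = 0" "u \<in> V \<Lambda> - {v}"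
  shows "x \<bullet> arc_vec \<Lambda>' u = x \<bullet> arc_vec \<Lambda> u"
proof -
  let ?t = "Transposition.transpose (upper \<Lambda> v) (lower \<Lambda> v)"
  have "upper \<Lambda>' u = upper \<Lambda> u \<and> lower \<Lambda>' u = lower \<Lambda> u \<or>
      upper \<Lambda>' u = ?t (upper \<Lambda> u) \<and> lower \<Lambda>' u = ?t (lower \<Lambda> u)"
    using assms(1,3) unfolding flips_def by blast
  moreover have "x $ ?t k = x $ k" for k
    using assms(2) by (simp add: inner_arc Transposition.transpose_def)
  ultimately show ?thesis by (auto simp: inner_arc)
qed

text \<open>Each flip in the star of \<open>S\<close> exchanges an arc orthogonal to
  \<open>x\<close> for its negative and shifts the brick vector orthogonally to \<open>x\<close>.
  With \<open>S = {v}\<close> this makes facet normals well defined, with \<open>S = {}\<close> and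
  a constant \<open>x\<close> it fixes the coordinate sum.\<close>

lemma star_invariant:
  assumes "\<Lambda> \<in> A" "\<Lambda>' \<in> A" "S \<subseteq> V \<Lambda>" "S \<subseteq> V \<Lambda>'" and "\<And>v. v \<in> V \<Lambda> - S \<Longrightarrow> x \<bullet> arc_vec \<Lambda> v = 0"
  shows "(\<forall>v\<in>S. x \<bullet> arc_vec \<Lambda>' v = x \<bullet> arc_vec \<Lambda> v) \<and> (\<forall>v\<in>V \<Lambda>' - S. x \<bullet> arc_vec \<Lambda>' v = 0) \<and>
    x \<bullet> \<omega> \<Lambda>' = x \<bullet> \<omega> \<Lambda>"
proof -
  define P where "P M \<longleftrightarrow> (\<forall>v\<in>S. x \<bullet> arc_vec M v = x \<bullet> arc_vec \<Lambda> v) \<and>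
    (\<forall>v\<in>V M - S. x \<bullet> arc_vec M v = 0) \<and> x \<bullet> \<omega> M = x \<bullet> \<omega> \<Lambda>" for M
  have "P \<Lambda>" using assms(5) by (simp add: P_def)
  have "P \<Lambda>'"
  proof (rule star_induct[where P = P, OF assms(1-4) \<open>P \<Lambda>\<close>])
    fix M v M' assume M: "M \<in> A" "M' \<in> A" "S \<subseteq> V M" "v \<in> V M - S" "flips M v M'"
    obtain w l where w: "w \<notin> V M" "V M' = insert w (V M - {v})"
      "upper M' w = lower M v" "lower M' w = upper M v" and \<omega>: "\<omega> M' = \<omega> M + l *\<^sub>R arc_vec M v"
      using M(5) unfolding flips_def by blast
    have w': "x \<bullet> arc_vec M' w = - (x \<bullet> arc_vec M v)" using w(3,4) by (simp add: inner_arc)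
    have "w \<in> V M' - S" using w(1,2) M(3) by blast
    show "P M \<longleftrightarrow> P M'"
    proof (cases "x \<bullet> arc_vec M v = 0")
      case True
      have V: "V M' - S = insert w (V M - {v} - S)" "V M - S = insert v (V M - {v} - S)"
        using w(1,2) M(3,4) by auto
      have "x \<bullet> arc_vec M' u = x \<bullet> arc_vec M u" if "u \<in> V M - {v}" for u
        using flips_inner_arc[OF M(5) True that] .
      then have "\<forall>u\<in>S. x \<bullet> arc_vec M' u = x \<bullet> arc_vec M u"
        "\<forall>u\<in>V M - {v} - S. x \<bullet> arc_vec M' u = x \<bullet> arc_vec M u"
        using M(3,4) by blast+
      moreover have "x \<bullet> \<omega> M' = x \<bullet> \<omega> M" using \<omega> True by (simp add: inner_add_right)
      ultimately show ?thesis
        unfolding P_def V using True w' by simp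
    next
      case False
      \<comment> \<open>The new contact \<open>w\<close> also lies outside \<open>S\<close> and
        carries the opposite nonzero value, so the invariant fails on both sides, as the equivalence
        in \<open>star_induct\<close> demands.\<close>
      then have "\<not> P M" "\<not> P M'"
        unfolding P_def using M(4) \<open>w \<in> V M' - S\<close> w' by fastforce+
      then show ?thesis by simp
    qed
  qed
  then show ?thesis by (simp add: P_def)
qed

section \<open>Uniqueness of sorted arrangements\<close>

text \<open>Read as a vector, \<open>c\<close> lies in the interior of the cone dual to the contact
  arcs.\<close>

definition sorted_by :: "('n \<Rightarrow> real) \<Rightarrow> 'a \<Rightarrow> bool" where
  "sorted_by c \<Lambda> \<longleftrightarrow> (\<forall>v\<in>V \<Lambda>. c (upper \<Lambda> v) < c (lower \<Lambda> v))"

text \<open>The correspondence between arrangements on the two sides of the wall \<open>c i = c j\<close>.\<close>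

definition transfer :: "'n \<Rightarrow> 'n \<Rightarrow> 'a \<Rightarrow> 'a \<Rightarrow> bool" where
  "transfer i j \<Lambda> \<Lambda>' \<longleftrightarrow>
     (\<forall>v\<in>V \<Lambda>. \<not> (upper \<Lambda> v = j \<and> lower \<Lambda> v = i)) \<and> \<Lambda>' = \<Lambda> \<or>
     (\<exists>v\<in>V \<Lambda>. upper \<Lambda> v = j \<and> lower \<Lambda> v = i \<and> flips \<Lambda> v \<Lambda>')"

text \<open>Passing the wall reverses the comparison of \<open>i\<close> and \<open>j\<close> only.
  A contact between them is sorted, hence has its arc from \<open>j\<close> to \<open>i\<close>, and
  the flip reverses it. Any other arc joins a pair whose comparison is unaffected, whether its ends
  get transposed or not.\<close>

lemma transfer_sorted:
  assumes "inj c" "c j < c i" "\<And>k. \<not> (c j < c k \<and> c k < c i)" "\<Lambda> \<in> A" "sorted_by c \<Lambda>"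
  obtains \<Lambda>' where "\<Lambda>' \<in> A" "sorted_by (c \<circ> Transposition.transpose i j) \<Lambda>'" "transfer i j \<Lambda> \<Lambda>'"
proof (cases "\<exists>v\<in>V \<Lambda>. upper \<Lambda> v = j \<and> lower \<Lambda> v = i")
  case False
  have "{upper \<Lambda> v, lower \<Lambda> v} \<noteq> {i, j}" if "v \<in> V \<Lambda>" for v
  proof
    assume "{upper \<Lambda> v, lower \<Lambda> v} = {i, j}"
    moreover have "c (upper \<Lambda> v) < c (lower \<Lambda> v)" using assms(5) that by (simp add: sorted_by_def)
    ultimately show False using assms(2) False that by (auto simp: doubleton_eq_iff)
  qed
  then have "sorted_by (c \<circ> Transposition.transpose i j) \<Lambda>"
    using assms(5) adjacent_transpose_less[OF assms(1-3)] by (auto simp: sorted_by_def)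
  moreover have "transfer i j \<Lambda> \<Lambda>" using False unfolding transfer_def by blast
  ultimately show thesis using that assms(4) by blast
next
  case True
  then obtain v where v: "v \<in> V \<Lambda>" "upper \<Lambda> v = j" "lower \<Lambda> v = i" by blast
  obtain \<Lambda>' where \<Lambda>': "\<Lambda>' \<in> A" "flips \<Lambda> v \<Lambda>'" using flip_exists[OF assms(4) v(1)] .
  obtain w where w: "V \<Lambda>' = insert w (V \<Lambda> - {v})" "upper \<Lambda>' w = i" "lower \<Lambda>' w = j" and
    arcs: "\<forall>u\<in>V \<Lambda> - {v}. upper \<Lambda>' u = upper \<Lambda> u \<and> lower \<Lambda>' u = lower \<Lambda> u \<or>
        upper \<Lambda>' u = Transposition.transpose j i (upper \<Lambda> u) \<and>
        lower \<Lambda>' u = Transposition.transpose j i (lower \<Lambda> u)"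
    using \<Lambda>'(2) v unfolding flips_def by blast
  have "(c \<circ> Transposition.transpose i j) (upper \<Lambda>' u) < (c \<circ> Transposition.transpose i j) (lower \<Lambda>' u)"
    if "u \<in> V \<Lambda>'" for u
  proof (cases "u = w")
    case True
    then show ?thesis using w assms(2) by simp
  next
    case False
    then have u: "u \<in> V \<Lambda> - {v}" using that w(1) by auto
    then have "{upper \<Lambda> u, lower \<Lambda> u} \<noteq> {i, j}"
      using no_parallel_arcs[OF assms(4) v(1), of u] no_antiparallel_arcs[OF assms(4) v(1), of u] v
      by (auto simp: doubleton_eq_iff)
    moreover have "c (upper \<Lambda> u) < c (lower \<Lambda> u)" using assms(5) u by (simp add: sorted_by_def)
    ultimately have "c (Transposition.transpose i j (upper \<Lambda> u)) < c (Transposition.transpose i j (lower \<Lambda> u))"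
      "c (upper \<Lambda> u) < c (lower \<Lambda> u)"
      using adjacent_transpose_less[OF assms(1-3), of "upper \<Lambda> u" "lower \<Lambda> u"] by blast+
    then show ?thesis
      using bspec[OF arcs u] unfolding transpose_commute[of j i] by (elim disjE conjE) simp_all
  qed
  then have "sorted_by (c \<circ> Transposition.transpose i j) \<Lambda>'" unfolding sorted_by_def by blast
  moreover have "transfer i j \<Lambda> \<Lambda>'" using v \<Lambda>'(2) unfolding transfer_def by blast
  ultimately show thesis using that \<Lambda>'(1) by blast
qed

text \<open>The target reveals its origin. If it arose by a flip it has an arc from \<open>i\<close>
  to \<open>j\<close>, which \<open>c\<close> forbids in \<open>\<Lambda>1\<close> and
  \<open>\<Lambda>2\<close>, so the two cases of \<open>transfer\<close> do not mix. That arc is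
  unique and fixes the new contact, while \<open>X\<close> fixes the contact it replaced.\<close>

lemma transfer_inj:
  assumes "\<Lambda>1 \<in> A" "\<Lambda>2 \<in> A" "\<Lambda>' \<in> A" "sorted_by c \<Lambda>1" "sorted_by c \<Lambda>2" "c j < c i"
    and tr: "transfer i j \<Lambda>1 \<Lambda>'" "transfer i j \<Lambda>2 \<Lambda>'"
  shows "\<Lambda>1 = \<Lambda>2"
proof -
  have no_flip: False if srt: "sorted_by c M'" and v: "upper M v = j" "lower M v = i" and "flips M v M'" for v M M'
  proof -
    obtain w where w: "V M' = insert w (V M - {v})" "upper M' w = lower M v" "lower M' w = upper M v"
      using flipsE[OF \<open>flips M v M'\<close>] .
    have "c (upper M' w) < c (lower M' w)" using srt w(1) unfolding sorted_by_def by blast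
    then show False using assms(6) by (simp add: w(2,3) v)
  qed
  show ?thesis
  proof (cases "\<Lambda>' = \<Lambda>1 \<or> \<Lambda>' = \<Lambda>2")
    case True
    then show ?thesis
    proof
      assume "\<Lambda>' = \<Lambda>1"
      then show ?thesis using tr(2) no_flip[OF assms(4)] unfolding transfer_def by blast
    next
      assume "\<Lambda>' = \<Lambda>2"
      then show ?thesis using tr(1) no_flip[OF assms(5)] unfolding transfer_def by blast
    qed
  next
    case False
    obtain v1 where v1: "v1 \<in> V \<Lambda>1" "upper \<Lambda>1 v1 = j" "lower \<Lambda>1 v1 = i" "flips \<Lambda>1 v1 \<Lambda>'"
      using tr(1) False unfolding transfer_def by blast
    obtain v2 where v2: "v2 \<in> V \<Lambda>2" "upper \<Lambda>2 v2 = j" "lower \<Lambda>2 v2 = i" "flips \<Lambda>2 v2 \<Lambda>'"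
      using tr(2) False unfolding transfer_def by blast
    obtain w1 where w1: "w1 \<notin> V \<Lambda>1" "V \<Lambda>' = insert w1 (V \<Lambda>1 - {v1})"
      "upper \<Lambda>' w1 = i" "lower \<Lambda>' w1 = j" "X \<Lambda>' j i = v1"
      using flipsE[OF v1(4)] unfolding v1(2,3) .
    obtain w2 where w2: "w2 \<notin> V \<Lambda>2" "V \<Lambda>' = insert w2 (V \<Lambda>2 - {v2})"
      "upper \<Lambda>' w2 = i" "lower \<Lambda>' w2 = j" "X \<Lambda>' j i = v2"
      using flipsE[OF v2(4)] unfolding v2(2,3) .
    have "w1 = w2" using no_parallel_arcs[OF assms(3), of w1 w2] w1(3,4) w2(3,4) w1(2)[THEN equalityD2] w2(2)[THEN equalityD2] by simp
    moreover have "v1 = v2" using w1(5) w2(5) by simp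
    moreover have "V \<Lambda>1 = insert v1 (V \<Lambda>' - {w1})" using w1(1,2) v1(1) by blast
    moreover have "V \<Lambda>2 = insert v2 (V \<Lambda>' - {w2})" using w2(1,2) v2(1) by blast
    ultimately have "V \<Lambda>1 = V \<Lambda>2" by simp
    then show ?thesis using inj_onD[OF inj_V _ assms(1,2)] by blast
  qed
qed

text \<open>The induction measures \<open>c\<close> by its inversions against the order of the
  lines. The exchange removes the inversion \<open>(i, j)\<close> and creates none; uniqueness for
  \<open>c'\<close> is pulled back to \<open>c\<close> by \<open>transfer_inj\<close>.\<close>

lemma sorted_by_unique:
  assumes "inj c" "\<Lambda>1 \<in> A" "\<Lambda>2 \<in> A" "sorted_by c \<Lambda>1" "sorted_by c \<Lambda>2"
  shows "\<Lambda>1 = \<Lambda>2"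
  using assms
proof (induction "card {(i, j). i < j \<and> c j < c i}" arbitrary: c \<Lambda>1 \<Lambda>2 rule: less_induct)
  case less
  show ?case
  proof (cases "strict_mono c")
    case True
    then show ?thesis
      using less.prems sorted_unique[of \<Lambda>1 \<Lambda>2 "{}"] by (auto simp: sorted_by_def strict_mono_less)
  next
    case False
    obtain i j where ij: "i < j" "c j < c i" "\<And>k. \<not> (c j < c k \<and> c k < c i)"
      using obtain_adjacent_inversion[OF less.prems(1) False] by metis
    define c' where "c' = c \<circ> Transposition.transpose i j"
    note adj = adjacent_transpose_less[OF less.prems(1) ij(2,3)]
    have "{(p, q). p < q \<and> c' q < c' p} \<subset> {(p, q). p < q \<and> c q < c p}"
    proof
      show "{(p, q). p < q \<and> c' q < c' p} \<subseteq> {(p, q). p < q \<and> c q < c p}"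
      proof safe
        fix p q assume pq: "p < q" "c' q < c' p"
        then have "{q, p} \<noteq> {i, j}"
          using ij by (auto simp: c'_def doubleton_eq_iff)
        then show "c q < c p" using adj pq by (simp add: c'_def)
      qed
      have "(i, j) \<in> {(p, q). p < q \<and> c q < c p}" "(i, j) \<notin> {(p, q). p < q \<and> c' q < c' p}"
        using ij by (auto simp: c'_def)
      then show "{(p, q). p < q \<and> c' q < c' p} \<noteq> {(p, q). p < q \<and> c q < c p}" by blast
    qed
    then have lt: "card {(p, q). p < q \<and> c' q < c' p} < card {(p, q). p < q \<and> c q < c p}"
      by (intro psubset_card_mono) auto
    have inj': "inj c'" unfolding c'_def by (intro inj_compose less.prems) simp
    obtain M1 where M1: "M1 \<in> A" "sorted_by c' M1" "transfer i j \<Lambda>1 M1"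
      using transfer_sorted[OF less.prems(1) ij(2,3) less.prems(2,4)] unfolding c'_def by metis
    obtain M2 where M2: "M2 \<in> A" "sorted_by c' M2" "transfer i j \<Lambda>2 M2"
      using transfer_sorted[OF less.prems(1) ij(2,3) less.prems(3,5)] unfolding c'_def by metis
    have "M1 = M2" using less.hyps[OF lt inj' M1(1) M2(1) M1(2) M2(2)] .
    then show ?thesis using transfer_inj[OF less.prems(2,3) M1(1) less.prems(4,5) ij(2) M1(3)] M2 by simp
  qed
qed

section \<open>Supports and optimality\<close>

text \<open>For \<open>x\<close> in \<open>W\<close> and in the dual cone these are the generators
  with positive coefficient in \<open>normal_expansion\<close>, so they span the smallest face of
  the cone containing \<open>x\<close>.\<close>

definition support :: "(real, 'n) vec \<Rightarrow> 'a \<Rightarrow> 'v set" where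
  "support x \<Lambda> = {v \<in> V \<Lambda>. x \<bullet> arc_vec \<Lambda> v > 0}"

text \<open>
  Breaking the ties of \<open>x\<close> by the order of the lines gives one injective \<open>c\<close> that sorts suitable
  arrangements in the stars of both supports, so that these arrangements coincide.
\<close>

lemma support_unique:
  assumes "\<Lambda> \<in> A" "\<Lambda>' \<in> A" "\<And>v. v \<in> V \<Lambda> \<Longrightarrow> 0 \<le> x \<bullet> arc_vec \<Lambda> v" "\<And>v. v \<in> V \<Lambda>' \<Longrightarrow> 0 \<le> x \<bullet> arc_vec \<Lambda>' v"
  shows "support x \<Lambda> = support x \<Lambda>'"
proof -
  define L where "L i = {k. x $ k < x $ i \<or> x $ k = x $ i \<and> k < i}" for i
  define c where "c i = real (card (L i))" for i
  have c_less: "c i < c j" if "x $ i < x $ j \<or> x $ i = x $ j \<and> i < j" for i j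
  proof -
    have "L i \<subset> L j" using that unfolding L_def by force
    then show ?thesis unfolding c_def by (simp add: psubset_card_mono)
  qed
  have "inj c"
  proof (rule injI, rule ccontr)
    fix i j assume "c i = c j" "i \<noteq> j"
    then show False using c_less[of i j] c_less[of j i] by (metis less_irrefl neq_iff)
  qed
  have *: "\<exists>M\<in>A. sorted_by c M \<and> support x M = support x \<Lambda>"
    if "\<Lambda> \<in> A" "\<And>v. v \<in> V \<Lambda> \<Longrightarrow> 0 \<le> x \<bullet> arc_vec \<Lambda> v" for \<Lambda>
  proof -
    let ?S = "support x \<Lambda>"
    have "M' \<in> {M \<in> A. ?S \<subseteq> V M}" if "M \<in> {M \<in> A. ?S \<subseteq> V M}" "v \<in> V M - ?S" "M' \<in> A" "flips M v M'" for M v M'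
      using that flips_keep[of M v M' ?S] by auto
    moreover have "\<Lambda> \<in> {M \<in> A. ?S \<subseteq> V M}" using that(1) by (auto simp: support_def)
    ultimately obtain M where M: "M \<in> A" "?S \<subseteq> V M"
      and srt: "\<And>v. v \<in> V M - ?S \<Longrightarrow> upper M v < lower M v"
      using exists_sorted[of "{M \<in> A. ?S \<subseteq> V M}" ?S] by (smt (verit) emptyE mem_Collect_eq subsetI)
    have "x \<bullet> arc_vec \<Lambda> v = 0" if "v \<in> V \<Lambda> - ?S" for v
      using \<open>\<And>v. v \<in> V \<Lambda> \<Longrightarrow> 0 \<le> x \<bullet> arc_vec \<Lambda> v\<close>[of v] that by (auto simp: support_def)
    then have inv: "\<forall>v\<in>?S. x \<bullet> arc_vec M v = x \<bullet> arc_vec \<Lambda> v" "\<forall>v\<in>V M - ?S. x \<bullet> arc_vec M v = 0"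
      using star_invariant[OF \<open>\<Lambda> \<in> A\<close> M(1) _ M(2)] by (auto simp: support_def)
    have pos: "0 < x \<bullet> arc_vec M v" if "v \<in> ?S" for v using inv(1) that by (simp add: support_def)
    have "support x M = ?S"
      using inv(2) pos M(2) by (force simp: support_def[of x M])
    \<comment> \<open>On contacts in the support \<open>x\<close> decides; on the others
      \<open>x\<close> is tied and \<open>srt\<close> breaks the tie.\<close>
    moreover have "c (upper M v) < c (lower M v)" if "v \<in> V M" for v
    proof (cases "v \<in> ?S")
      case True
      then show ?thesis using pos[of v] by (intro c_less) (simp add: inner_arc)
    next
      case False
      then show ?thesis using inv(2) srt[of v] that by (intro c_less) (auto simp: inner_arc)
    qed
    ultimately show ?thesis using M by (auto simp: sorted_by_def)
  qed
  obtain M where M: "M \<in> A" "sorted_by c M" "support x M = support x \<Lambda>"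
    using *[OF assms(1,3)] by blast
  obtain M' where M': "M' \<in> A" "sorted_by c M'" "support x M' = support x \<Lambda>'"
    using *[OF assms(2,4)] by blast
  show ?thesis using sorted_by_unique[OF \<open>inj c\<close> M(1) M'(1) M(2) M'(2)] M M' by simp
qed

lemma minimizer_inner_arc:
  assumes "\<Lambda> \<in> A" "\<And>M. M \<in> A \<Longrightarrow> x \<bullet> \<omega> \<Lambda> \<le> x \<bullet> \<omega> M" "v \<in> V \<Lambda>"
  shows "0 \<le> x \<bullet> arc_vec \<Lambda> v"
proof -
  obtain \<Lambda>' where \<Lambda>': "\<Lambda>' \<in> A" "flips \<Lambda> v \<Lambda>'" using flip_exists[OF assms(1,3)] .
  then obtain l where "0 < l" "\<omega> \<Lambda>' = \<omega> \<Lambda> + l *\<^sub>R arc_vec \<Lambda> v" by (auto simp: flips_def)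
  then show ?thesis using assms(2)[OF \<Lambda>'(1)] by (simp add: inner_add_right zero_le_mult_iff)
qed

lemma exists_minimizer: fixes x :: "(real, 'n) vec" 
  obtains \<Lambda> where "\<Lambda> \<in> A" "\<And>M. M \<in> A \<Longrightarrow> x \<bullet> \<omega> \<Lambda> \<le> x \<bullet> \<omega> M"
  using ex_is_arg_min_if_finite[OF finite_A A_nonempty, of "\<lambda>M. x \<bullet> \<omega> M"] that
  unfolding is_arg_min_linorder by blast

lemma inner_eq_if_support_subset:
  assumes "\<Lambda> \<in> A" "\<Lambda>' \<in> A" "\<And>v. v \<in> V \<Lambda> \<Longrightarrow> 0 \<le> x \<bullet> arc_vec \<Lambda> v" "support x \<Lambda> \<subseteq> V \<Lambda>'"
  shows "x \<bullet> \<omega> \<Lambda>' = x \<bullet> \<omega> \<Lambda>"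
proof -
  have "x \<bullet> arc_vec \<Lambda> v = 0" if "v \<in> V \<Lambda> - support x \<Lambda>" for v
    using assms(3)[of v] that by (auto simp: support_def)
  then show ?thesis
    using star_invariant[OF assms(1,2) _ assms(4)] by (auto simp: support_def)
qed

text \<open>Both \<Lambda> and a global minimizer \<open>M\<close> have only nonnegative arcs, so
  their supports agree, and \<open>M\<close> lies in the star of the support, on which
  \<open>x\<close> is constant.\<close>

lemma optimal:
  assumes "\<Lambda> \<in> A" "\<Lambda>' \<in> A" "\<And>v. v \<in> V \<Lambda> \<Longrightarrow> 0 \<le> x \<bullet> arc_vec \<Lambda> v"
  shows "x \<bullet> \<omega> \<Lambda> \<le> x \<bullet> \<omega> \<Lambda>'"
proof -
  obtain M where M: "M \<in> A" "\<And>M'. M' \<in> A \<Longrightarrow> x \<bullet> \<omega> M \<le> x \<bullet> \<omega> M'"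
    using exists_minimizer[of x] by blast
  have "support x \<Lambda> = support x M"
    using support_unique[OF assms(1) M(1) assms(3) minimizer_inner_arc[OF M]] by blast
  then have "x \<bullet> \<omega> M = x \<bullet> \<omega> \<Lambda>"
    using inner_eq_if_support_subset[OF assms(1) M(1) assms(3)] by (auto simp: support_def)
  then show ?thesis using M(2)[OF assms(2)] by simp
qed

text \<open>An arrangement with the optimal value is a minimizer too and so has the same support.
  Thus the face minimizing \<open>x\<close> corresponds to the star of the support, which links
  faces to the complex.\<close>

lemma optimal_eq_iff:
  assumes "\<Lambda> \<in> A" "\<Lambda>' \<in> A" "\<And>v. v \<in> V \<Lambda> \<Longrightarrow> 0 \<le> x \<bullet> arc_vec \<Lambda> v"
  shows "x \<bullet> \<omega> \<Lambda>' = x \<bullet> \<omega> \<Lambda> \<longleftrightarrow> support x \<Lambda> \<subseteq> V \<Lambda>'"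
proof
  assume eq: "x \<bullet> \<omega> \<Lambda>' = x \<bullet> \<omega> \<Lambda>"
  have "0 \<le> x \<bullet> arc_vec \<Lambda>' v" if "v \<in> V \<Lambda>'" for v
    using minimizer_inner_arc[OF assms(2) _ that] optimal[OF assms(1) _ assms(3)] eq by auto
  then have "support x \<Lambda> = support x \<Lambda>'" using support_unique[OF assms(1,2,3)] by blast
  then show "support x \<Lambda> \<subseteq> V \<Lambda>'" by (auto simp: support_def)
qed (use inner_eq_if_support_subset[OF assms] in blast)

section \<open>Facet normals, vertices and edges\<close>

lemma ex_normal:
  assumes "\<Lambda> \<in> A" "v \<in> V \<Lambda>"
  shows "\<exists>c\<in>W. \<forall>u\<in>V \<Lambda>. c \<bullet> arc_vec \<Lambda> u = (if u = v then 1 else 0)"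
proof -
  obtain g :: "(real, 'n) vec \<Rightarrow> real" where g: "linear g"
    "\<forall>x\<in>arc_vec \<Lambda> ` V \<Lambda>. g x = (if x = arc_vec \<Lambda> v then 1 else 0)"
    using linear_independent_extend[OF independent_arcs[OF assms(1)], of "\<lambda>x. if x = arc_vec \<Lambda> v then 1 else 0"]
    by blast
  \<comment> \<open>\<open>d\<close> represents \<open>g\<close> by the inner product. Subtracting
    the mean in \<open>c\<close> moves it into \<open>W\<close> and leaves its values on arcs, which
    are coordinate differences.\<close>
  define d where "d = adjoint g 1"
  define c :: "(real, 'n) vec" where "c = (\<chi> i. d $ i - (\<Sum>k\<in>UNIV. d $ k) / CARD('n))"
  have "c \<in> W" by (simp add: W_def c_def sum_subtractf)
  moreover have "c \<bullet> arc_vec \<Lambda> u = (if u = v then 1 else 0)" if "u \<in> V \<Lambda>" for u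
  proof -
    have "c \<bullet> arc_vec \<Lambda> u = arc_vec \<Lambda> u \<bullet> d"
      unfolding inner_commute[of "arc_vec \<Lambda> u"] by (simp add: inner_arc c_def)
    also have "\<dots> = g (arc_vec \<Lambda> u)"
      unfolding d_def by (simp add: adjoint_works[OF g(1)])
    also have "\<dots> = (if u = v then 1 else 0)"
      using g(2) that assms(2) inj_onD[OF inj_on_arc[OF assms(1)], of u v] by auto
    finally show ?thesis .
  qed
  ultimately show ?thesis by blast
qed

text \<open>By invariance along the star of \<open>v\<close>, the choice of \<open>\<Lambda>\<close> does not matter.\<close>

definition normal :: "'v \<Rightarrow> (real, 'n) vec" where
  "normal v = (SOME c. c \<in> W \<and> (\<exists>\<Lambda>\<in>A. v \<in> V \<Lambda> \<and>
     (\<forall>u\<in>V \<Lambda>. c \<bullet> arc_vec \<Lambda> u = (if u = v then 1 else 0))))"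

lemma normal_in_W: "\<Lambda> \<in> A \<Longrightarrow> v \<in> V \<Lambda> \<Longrightarrow> normal v \<in> W"
  and inner_normal_arc: "\<Lambda> \<in> A \<Longrightarrow> v \<in> V \<Lambda> \<Longrightarrow> u \<in> V \<Lambda> \<Longrightarrow>
    normal v \<bullet> arc_vec \<Lambda> u = (if u = v then 1 else 0)"
proof -
  assume \<Lambda>: "\<Lambda> \<in> A" "v \<in> V \<Lambda>"
  have "\<exists>c. c \<in> W \<and> (\<exists>\<Lambda>\<in>A. v \<in> V \<Lambda> \<and> (\<forall>u\<in>V \<Lambda>. c \<bullet> arc_vec \<Lambda> u = (if u = v then 1 else 0)))"
    using ex_normal[OF \<Lambda>] \<Lambda> by blast
  from someI_ex[OF this] have n: "normal v \<in> W"
    "\<exists>\<Lambda>\<in>A. v \<in> V \<Lambda> \<and> (\<forall>u\<in>V \<Lambda>. normal v \<bullet> arc_vec \<Lambda> u = (if u = v then 1 else 0))"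
    unfolding normal_def[symmetric] by blast+
  show "normal v \<in> W" by (rule n(1))
  assume u: "u \<in> V \<Lambda>"
  obtain M where M: "M \<in> A" "v \<in> V M" "\<And>u. u \<in> V M \<Longrightarrow> normal v \<bullet> arc_vec M u = (if u = v then 1 else 0)"
    using n(2) by blast
  have "(\<forall>u\<in>{v}. normal v \<bullet> arc_vec \<Lambda> u = normal v \<bullet> arc_vec M u) \<and>
    (\<forall>u\<in>V \<Lambda> - {v}. normal v \<bullet> arc_vec \<Lambda> u = 0) \<and> normal v \<bullet> \<omega> \<Lambda> = normal v \<bullet> \<omega> M"
    by (rule star_invariant) (use \<Lambda> M in simp_all)
  then show "normal v \<bullet> arc_vec \<Lambda> u = (if u = v then 1 else 0)"
    using M(2,3) u by simp
qed

lemma support_normal: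
  assumes "\<Lambda> \<in> A" "v \<in> V \<Lambda>" shows "support (normal v) \<Lambda> = {v}"
  using inner_normal_arc[OF assms] assms(2) by (auto simp: support_def split: if_splits)

lemma orthogonal_to_arcs:
  assumes "\<Lambda> \<in> A" "x \<in> W" "\<And>v. v \<in> V \<Lambda> \<Longrightarrow> x \<bullet> arc_vec \<Lambda> v = 0" shows "x = 0"
proof -
  have "x \<in> span (arc_vec \<Lambda> ` V \<Lambda>)" using assms(2) by (simp add: span_arcs[OF assms(1)])
  then have "orthogonal x x"
    by (rule orthogonal_to_span) (use assms(3) in \<open>auto simp: orthogonal_def\<close>)
  then show ?thesis by (simp add: orthogonal_self)
qed

text \<open>The normals are the basis of \<open>W\<close> dual to the arcs: both sides have the same
  inner products with the arcs, and these span \<open>W\<close>.\<close>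

lemma normal_expansion:
  assumes "\<Lambda> \<in> A" "x \<in> W"
  shows "x = (\<Sum>v\<in>V \<Lambda>. (x \<bullet> arc_vec \<Lambda> v) *\<^sub>R normal v)"
proof -
  let ?y = "\<Sum>v\<in>V \<Lambda>. (x \<bullet> arc_vec \<Lambda> v) *\<^sub>R normal v"
  have "x - ?y = 0"
  proof (rule orthogonal_to_arcs[OF assms(1)])
    show "x - ?y \<in> W"
      by (intro subspace_diff subspace_sum subspace_scale subspace_W assms(2) normal_in_W[OF assms(1)])
    fix u assume u: "u \<in> V \<Lambda>"
    have "?y \<bullet> arc_vec \<Lambda> u = (\<Sum>v\<in>V \<Lambda>. (x \<bullet> arc_vec \<Lambda> v) * (if u = v then 1 else 0))"
      unfolding inner_sum_left by (rule sum.cong) (simp_all add: inner_normal_arc[OF assms(1) _ u])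
    then show "(x - ?y) \<bullet> arc_vec \<Lambda> u = 0"
      using u finite_V[OF assms(1)] by (simp add: inner_diff_left mult_delta_right)
  qed
  then show ?thesis by simp
qed

lemma orthogonal_to_normals:
  assumes "\<Lambda> \<in> A" "x \<in> W" "\<And>v. v \<in> V \<Lambda> \<Longrightarrow> normal v \<bullet> x = 0" shows "x = 0"
proof -
  have "x \<bullet> x = (\<Sum>v\<in>V \<Lambda>. (x \<bullet> arc_vec \<Lambda> v) *\<^sub>R normal v) \<bullet> x"
    using normal_expansion[OF assms(1,2)] by simp
  also have "\<dots> = 0" by (simp add: inner_sum_left assms(3))
  finally show ?thesis by simp
qed

text \<open>The star of the empty set is all of \<open>A\<close>, and the all-ones vector is
  orthogonal to every arc, so all brick vectors have the same coordinate sum.\<close>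

lemma \<omega>_diff_in_W:
  assumes "\<Lambda> \<in> A" "M \<in> A" shows "\<omega> M - \<omega> \<Lambda> \<in> W"
proof -
  let ?one = "(\<chi> i. 1) :: (real, 'n) vec"
  have "?one \<bullet> arc_vec \<Lambda> v = 0" for v by (simp add: inner_arc)
  then have "?one \<bullet> \<omega> M = ?one \<bullet> \<omega> \<Lambda>"
    using star_invariant[OF assms, of "{}" ?one] by simp
  then show ?thesis by (simp add: W_eq_hyperplane inner_diff_right)
qed

section \<open>Faces of the polytope from stars\<close>

text \<open>A point in the relative interior of the cone generated by the normals of
  \<open>S\<close>. Its support is exactly \<open>S\<close>, so minimizing it exposes the face
  belonging to \<open>S\<close>.\<close>

definition cone_vec :: "'v set \<Rightarrow> (real, 'n) vec" where
  "cone_vec S = (\<Sum>v\<in>S. normal v)"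

lemma inner_cone_vec:
  assumes "\<Lambda> \<in> A" "S \<subseteq> V \<Lambda>" "u \<in> V \<Lambda>"
  shows "cone_vec S \<bullet> arc_vec \<Lambda> u = (if u \<in> S then 1 else 0)"
proof -
  have "finite S" using finite_V[OF assms(1)] assms(2) by (rule finite_subset[rotated])
  have "cone_vec S \<bullet> arc_vec \<Lambda> u = (\<Sum>v\<in>S. if u = v then 1 else 0)"
    unfolding cone_vec_def inner_sum_left
    using assms by (intro sum.cong) (auto simp: inner_normal_arc[OF assms(1)])
  also have "\<dots> = (if u \<in> S then 1 else 0)" using \<open>finite S\<close> by simp
  finally show ?thesis .
qed

lemma support_cone_vec:
  assumes "\<Lambda> \<in> A" "S \<subseteq> V \<Lambda>" shows "support (cone_vec S) \<Lambda> = S"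
  using inner_cone_vec[OF assms] assms(2) by (auto simp: support_def split: if_splits)

abbreviation P :: "(real, 'n) vec set" where
  "P \<equiv> convex hull (\<omega> ` A)"

lemma inner_ge_on_P:
  assumes "\<Lambda> \<in> A" "\<And>v. v \<in> V \<Lambda> \<Longrightarrow> 0 \<le> x \<bullet> arc_vec \<Lambda> v" "y \<in> P"
  shows "x \<bullet> \<omega> \<Lambda> \<le> x \<bullet> y"
proof -
  have "P \<subseteq> {y. x \<bullet> \<omega> \<Lambda> \<le> x \<bullet> y}"
  proof (rule hull_minimal)
    show "\<omega> ` A \<subseteq> {y. x \<bullet> \<omega> \<Lambda> \<le> x \<bullet> y}" using optimal[OF assms(1) _ assms(2)] by blast
    show "convex {y. x \<bullet> \<omega> \<Lambda> \<le> x \<bullet> y}" using convex_halfspace_ge[of "x \<bullet> \<omega> \<Lambda>" x] by simp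
  qed
  then show ?thesis using assms(3) by blast
qed

text \<open>Among brick vectors, \<open>cone_vec S\<close> is minimal exactly on the star of
  \<open>S\<close>, and a face of a convex hull is the hull of some of its generators.\<close>

lemma star_face:
  assumes "\<Lambda> \<in> A" "S \<subseteq> V \<Lambda>"
  shows "convex hull (\<omega> ` {M \<in> A. S \<subseteq> V M}) face_of P"
proof -
  let ?x = "cone_vec S"
  have pos: "\<And>v. v \<in> V \<Lambda> \<Longrightarrow> 0 \<le> ?x \<bullet> arc_vec \<Lambda> v" by (simp add: inner_cone_vec[OF assms])
  define F where "F = P \<inter> {y. ?x \<bullet> y = ?x \<bullet> \<omega> \<Lambda>}"
  have F: "F face_of P" unfolding F_def
    by (rule face_of_Int_supporting_hyperplane_ge[OF convex_convex_hull inner_ge_on_P[OF assms(1) pos]])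
  have \<omega>_F: "\<omega> M \<in> F \<longleftrightarrow> S \<subseteq> V M" if "M \<in> A" for M
    using optimal_eq_iff[OF assms(1) that pos] that
    unfolding F_def support_cone_vec[OF assms] by (simp add: hull_inc)
  have "compact (\<omega> ` A)" using finite_A by (simp add: finite_imp_compact)
  then obtain B where B: "B \<subseteq> \<omega> ` A" "F = convex hull B" using face_of_convex_hull_subset F by metis
  have "B \<subseteq> F" unfolding B(2) by (rule hull_subset)
  then have "B \<subseteq> \<omega> ` {M \<in> A. S \<subseteq> V M}" using B(1) \<omega>_F by blast
  then have "F \<subseteq> convex hull (\<omega> ` {M \<in> A. S \<subseteq> V M})" unfolding B(2) by (rule hull_mono)
  moreover have "convex hull (\<omega> ` {M \<in> A. S \<subseteq> V M}) \<subseteq> F"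
    by (rule hull_minimal) (use \<omega>_F face_of_imp_convex[OF F] in auto)
  ultimately show ?thesis using F by simp
qed

lemma V_subset_imp_eq:
  assumes "\<Lambda> \<in> A" "M \<in> A" "V \<Lambda> \<subseteq> V M" shows "M = \<Lambda>"
proof -
  have "V \<Lambda> = V M"
    using assms card_V by (intro card_subset_eq finite_V) auto
  then show ?thesis using inj_onD[OF inj_V] assms by metis
qed

lemma extreme_\<omega>: assumes "\<Lambda> \<in> A" shows "\<omega> \<Lambda> extreme_point_of P"
proof -
  have "{M \<in> A. V \<Lambda> \<subseteq> V M} = {\<Lambda>}" using V_subset_imp_eq assms by blast
  then have "{\<omega> \<Lambda>} face_of P" using star_face[OF assms order_refl] by simp
  then show ?thesis by (simp add: face_of_singleton)
qed

lemma inj_\<omega>: "inj_on \<omega> A"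
proof (rule inj_onI)
  fix \<Lambda> M assume *: "\<Lambda> \<in> A" "M \<in> A" "\<omega> \<Lambda> = \<omega> M"
  have "\<And>v. v \<in> V \<Lambda> \<Longrightarrow> 0 \<le> cone_vec (V \<Lambda>) \<bullet> arc_vec \<Lambda> v"
    by (simp add: inner_cone_vec[OF *(1) order_refl])
  then have "V \<Lambda> \<subseteq> V M"
    using optimal_eq_iff[OF *(1,2), of "cone_vec (V \<Lambda>)"] *(3) support_cone_vec[OF *(1) order_refl] by simp
  then show "\<Lambda> = M" using V_subset_imp_eq[OF *(1,2)] by simp
qed

lemma extreme_points_P: "{x. x extreme_point_of P} = \<omega> ` A"
  using extreme_\<omega> extreme_points_of_convex_hull[of "\<omega> ` A"] by blast

lemma flips_neq: assumes "flips \<Lambda> v \<Lambda>'" "v \<in> V \<Lambda>" shows "\<Lambda>' \<noteq> \<Lambda>"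
  using assms unfolding flips_def by blast

text \<open>A member \<open>M\<close> of this star agrees with \<Lambda> on all normals except that
  of \<open>v\<close>, so its brick vector lies on the line through the one of \<Lambda> along the
  flipped arc. Three distinct brick vectors on a line cannot all be extreme.\<close>

lemma ridge:
  assumes "\<Lambda> \<in> A" "v \<in> V \<Lambda>" "\<Lambda>' \<in> A" "flips \<Lambda> v \<Lambda>'"
  shows "{M \<in> A. V \<Lambda> - {v} \<subseteq> V M} = {\<Lambda>, \<Lambda>'}"
proof -
  obtain l where l: "0 < l" "\<omega> \<Lambda>' = \<omega> \<Lambda> + l *\<^sub>R arc_vec \<Lambda> v" using assms(4) unfolding flips_def by blast
  have "M = \<Lambda> \<or> M = \<Lambda>'" if M: "M \<in> A" "V \<Lambda> - {v} \<subseteq> V M" for M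
  proof (rule ccontr)
    assume neq: "\<not> (M = \<Lambda> \<or> M = \<Lambda>')"
    \<comment> \<open>\<open>normal v\<close> is 1 on the arc of \<open>v\<close>, so
      \<open>t\<close> is the only candidate for the coordinate along this arc.\<close>
    define t where "t = normal v \<bullet> (\<omega> M - \<omega> \<Lambda>)"
    have pos: "0 \<le> normal w \<bullet> arc_vec \<Lambda> u" if "w \<in> V \<Lambda>" "u \<in> V \<Lambda>" for u w
      using inner_normal_arc[OF assms(1) that] by simp
    have "\<omega> M - \<omega> \<Lambda> - t *\<^sub>R arc_vec \<Lambda> v = 0"
    proof (rule orthogonal_to_normals[OF assms(1)])
      show "\<omega> M - \<omega> \<Lambda> - t *\<^sub>R arc_vec \<Lambda> v \<in> W"
        by (intro subspace_diff[OF subspace_W] subspace_scale[OF subspace_W] \<omega>_diff_in_W arc_in_W assms(1) M(1))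
      fix w assume w: "w \<in> V \<Lambda>"
      show "normal w \<bullet> (\<omega> M - \<omega> \<Lambda> - t *\<^sub>R arc_vec \<Lambda> v) = 0"
      proof (cases "w = v")
        case True
        then show ?thesis using inner_normal_arc[OF assms(1,2,2)] by (simp add: t_def inner_diff_right)
      next
        case False
        then have "normal w \<bullet> \<omega> M = normal w \<bullet> \<omega> \<Lambda>"
          using inner_eq_if_support_subset[OF assms(1) M(1) pos[OF w]] M(2) w
          by (auto simp: support_normal[OF assms(1) w])
        then show ?thesis using inner_normal_arc[OF assms(1) w assms(2)] False
          by (simp add: inner_diff_right)
      qed
    qed
    then have \<omega>M: "\<omega> M = \<omega> \<Lambda> + t *\<^sub>R arc_vec \<Lambda> v" by (simp add: algebra_simps)
    have "t \<ge> 0" using optimal[OF assms(1) M(1) pos[OF assms(2)]] by (simp add: t_def inner_diff_right)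
    moreover have "\<omega> M \<noteq> \<omega> \<Lambda>" "\<omega> M \<noteq> \<omega> \<Lambda>'" "\<omega> \<Lambda> \<noteq> \<omega> \<Lambda>'"
      using neq inj_onD[OF inj_\<omega>] assms(1,3) M(1) flips_neq[OF assms(4,2)] by metis+
    ultimately have "0 < t" "t \<noteq> l" using \<omega>M l by auto
    have between: "\<omega> \<Lambda> + r *\<^sub>R arc_vec \<Lambda> v \<in> open_segment (\<omega> \<Lambda>) (\<omega> \<Lambda> + s *\<^sub>R arc_vec \<Lambda> v)"
      if "0 < r" "r < s" "\<omega> \<Lambda> \<noteq> \<omega> \<Lambda> + s *\<^sub>R arc_vec \<Lambda> v" for r s
    proof -
      have "\<omega> \<Lambda> + r *\<^sub>R arc_vec \<Lambda> v = (1 - r / s) *\<^sub>R \<omega> \<Lambda> + (r / s) *\<^sub>R (\<omega> \<Lambda> + s *\<^sub>R arc_vec \<Lambda> v)"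
        using that(1,2) by (simp add: algebra_simps)
      then show ?thesis using that unfolding in_segment(2) by (intro conjI exI[of _ "r / s"]) auto
    qed
    show False
    proof (cases "t < l")
      case True
      have "\<omega> M \<in> open_segment (\<omega> \<Lambda>) (\<omega> \<Lambda>')"
        unfolding \<omega>M l(2) by (rule between[OF \<open>0 < t\<close> True]) (use \<open>\<omega> \<Lambda> \<noteq> \<omega> \<Lambda>'\<close> l in simp)
      then show False using extreme_\<omega>[OF M(1)] assms(1,3) unfolding extreme_point_of_def
        by (meson hull_inc imageI)
    next
      case False
      then have "l < t" using \<open>t \<noteq> l\<close> by simp
      have "\<omega> \<Lambda>' \<in> open_segment (\<omega> \<Lambda>) (\<omega> M)"
        unfolding \<omega>M l(2) by (rule between[OF \<open>0 < l\<close> \<open>l < t\<close>]) (use \<open>\<omega> M \<noteq> \<omega> \<Lambda>\<close> \<omega>M in simp)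
      then show False using extreme_\<omega>[OF assms(3)] assms(1) M(1) unfolding extreme_point_of_def
        by (meson hull_inc imageI)
    qed
  qed
  moreover have "V \<Lambda> - {v} \<subseteq> V \<Lambda>'" using assms(4) unfolding flips_def by blast
  ultimately show ?thesis using assms(1,3) by blast
qed

text \<open>A flip gives an edge because the star in \<open>ridge\<close> has two members.
  Conversely, let \<open>S\<close> be the support of a functional exposing the edge. A contact of
  \<Lambda> outside \<open>S\<close> exists, and flipping it stays on the edge, so it leads to the
  other end.\<close>

lemma edge_of_P_iff:
  "closed_segment x y edge_of P \<longleftrightarrow>
   (\<exists>\<Lambda>\<in>A. \<exists>v\<in>V \<Lambda>. \<exists>\<Lambda>'\<in>A. flips \<Lambda> v \<Lambda>' \<and> x = \<omega> \<Lambda> \<and> y = \<omega> \<Lambda>')"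
proof
  assume "\<exists>\<Lambda>\<in>A. \<exists>v\<in>V \<Lambda>. \<exists>\<Lambda>'\<in>A. flips \<Lambda> v \<Lambda>' \<and> x = \<omega> \<Lambda> \<and> y = \<omega> \<Lambda>'"
  then obtain \<Lambda> v \<Lambda>' where *: "\<Lambda> \<in> A" "v \<in> V \<Lambda>" "\<Lambda>' \<in> A" "flips \<Lambda> v \<Lambda>'" "x = \<omega> \<Lambda>" "y = \<omega> \<Lambda>'" by blast
  have "closed_segment x y = convex hull (\<omega> ` {M \<in> A. V \<Lambda> - {v} \<subseteq> V M})"
    unfolding ridge[OF *(1-4)] by (simp add: segment_convex_hull *)
  moreover have "x \<noteq> y" using inj_onD[OF inj_\<omega> _ *(1,3)] flips_neq[OF *(4,2)] * by metis
  moreover from this have "aff_dim (closed_segment x y) = 1"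
    by (simp add: segment_convex_hull aff_dim_convex_hull)
  ultimately show "closed_segment x y edge_of P"
    using star_face[OF *(1), of "V \<Lambda> - {v}"] unfolding edge_of_def by simp
next
  assume e: "closed_segment x y edge_of P"
  then have face: "closed_segment x y face_of P" and "x \<noteq> y"
    by (auto simp: edge_of_def)
  have "x extreme_point_of P" "y extreme_point_of P"
    using extreme_point_of_face[OF face] by (auto simp: extreme_point_of_segment)
  then obtain \<Lambda> M where \<Lambda>: "\<Lambda> \<in> A" "x = \<omega> \<Lambda>" and M: "M \<in> A" "y = \<omega> M"
    using extreme_points_P by blast
  have "polyhedron P"
    using finite_A by (intro polytope_imp_polyhedron polytope_convex_hull) simp
  then have "closed_segment x y exposed_face_of P" using face by (simp add: exposed_face_of_polyhedron)
  \<comment> \<open>\<open>a\<close> is maximal on the edge, so \<open>- a\<close> is the functional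
    to be minimized.\<close>
  then obtain a b where a: "P \<subseteq> {x. a \<bullet> x \<le> b}" "closed_segment x y = P \<inter> {x. a \<bullet> x = b}"
    unfolding exposed_face_of_def by blast
  have mem: "\<omega> \<Lambda>' \<in> closed_segment x y \<longleftrightarrow> (- a) \<bullet> \<omega> \<Lambda>' = (- a) \<bullet> \<omega> \<Lambda>" if "\<Lambda>' \<in> A" for \<Lambda>'
  proof -
    have "a \<bullet> \<omega> \<Lambda> = b" using ends_in_segment(1)[of x y] a(2) \<Lambda> by blast
    then show ?thesis using that unfolding a(2) by (auto simp: hull_inc)
  qed
  have pos: "0 \<le> (- a) \<bullet> arc_vec \<Lambda> v" if "v \<in> V \<Lambda>" for v
  proof (rule minimizer_inner_arc[OF \<Lambda>(1) _ that])
    fix \<Lambda>' assume "\<Lambda>' \<in> A"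
    then have "a \<bullet> \<omega> \<Lambda>' \<le> b" using a(1) hull_inc[of "\<omega> \<Lambda>'" "\<omega> ` A" convex] by blast
    moreover have "a \<bullet> \<omega> \<Lambda> = b" using ends_in_segment(1)[of x y] a(2) \<Lambda> by blast
    ultimately show "(- a) \<bullet> \<omega> \<Lambda> \<le> (- a) \<bullet> \<omega> \<Lambda>'" by simp
  qed
  define S where "S = support (- a) \<Lambda>"
  have S: "\<omega> \<Lambda>' \<in> closed_segment x y \<longleftrightarrow> S \<subseteq> V \<Lambda>'" if "\<Lambda>' \<in> A" for \<Lambda>'
    using mem[OF that] optimal_eq_iff[OF \<Lambda>(1) that pos] by (simp add: S_def)
  have "S \<subseteq> V M" using S[OF M(1)] M by simp
  moreover have "\<Lambda> \<noteq> M" using \<open>x \<noteq> y\<close> \<Lambda> M by blast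
  moreover have "S \<subseteq> V \<Lambda>" by (auto simp: S_def support_def)
  ultimately obtain v where v: "v \<in> V \<Lambda>" "v \<notin> S" using V_subset_imp_eq[OF \<Lambda>(1) M(1)] by blast
  obtain \<Lambda>' where \<Lambda>': "\<Lambda>' \<in> A" "flips \<Lambda> v \<Lambda>'" using flip_exists[OF \<Lambda>(1) v(1)] .
  have "\<omega> \<Lambda>' \<in> closed_segment x y"
    using S[OF \<Lambda>'(1)] flips_keep[OF \<Lambda>'(2) \<open>S \<subseteq> V \<Lambda>\<close> v(2)] by blast
  then have "\<omega> \<Lambda>' extreme_point_of closed_segment x y"
    using extreme_point_of_face[OF face] extreme_\<omega>[OF \<Lambda>'(1)] by blast
  then have "\<omega> \<Lambda>' = \<omega> \<Lambda> \<or> \<omega> \<Lambda>' = y" using \<Lambda>(2) extreme_point_of_segment by blast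
  then have "\<omega> \<Lambda>' = y" using inj_onD[OF inj_\<omega> _ \<Lambda>'(1) \<Lambda>(1)] flips_neq[OF \<Lambda>'(2) v(1)] by blast
  then show "\<exists>\<Lambda>\<in>A. \<exists>v\<in>V \<Lambda>. \<exists>\<Lambda>'\<in>A. flips \<Lambda> v \<Lambda>' \<and> x = \<omega> \<Lambda> \<and> y = \<omega> \<Lambda>'"
    using \<Lambda> v \<Lambda>' by blast
qed

section \<open>The polar\<close>

definition \<Delta> :: "'v set set" where
  "\<Delta> = {S. \<exists>\<Lambda>\<in>A. S \<subseteq> V \<Lambda>}"

lemma facet_value:
  assumes "\<Lambda> \<in> A" "M \<in> A" "v \<in> V \<Lambda>" "v \<in> V M"
  shows "normal v \<bullet> \<omega> M = normal v \<bullet> \<omega> \<Lambda>"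
  using inner_eq_if_support_subset[OF assms(1,2), of "normal v"] assms(4)
  by (simp add: support_normal[OF assms(1,3)] inner_normal_arc[OF assms(1,3)])

lemma normal_le:
  assumes "\<Lambda> \<in> A" "v \<in> V \<Lambda>" "y \<in> P" shows "normal v \<bullet> \<omega> \<Lambda> \<le> normal v \<bullet> y"
  by (rule inner_ge_on_P[OF assms(1) _ assms(3)]) (simp add: inner_normal_arc[OF assms(1,2)])

lemma normal_eq_iff:
  assumes "\<Lambda> \<in> A" "M \<in> A" "v \<in> V \<Lambda>"
  shows "normal v \<bullet> \<omega> M = normal v \<bullet> \<omega> \<Lambda> \<longleftrightarrow> v \<in> V M"
  using optimal_eq_iff[OF assms(1,2), of "normal v"]
  by (simp add: support_normal[OF assms(1,3)] inner_normal_arc[OF assms(1,3)])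

text \<open>Flipping \<open>v\<close> away leaves the face where \<open>normal v\<close> is minimal,
  so this face is proper and misses the relative interior.\<close>

lemma normal_less_rel_interior:
  assumes "z \<in> rel_interior P" "\<Lambda> \<in> A" "v \<in> V \<Lambda>"
  shows "normal v \<bullet> \<omega> \<Lambda> < normal v \<bullet> z"
proof -
  let ?F = "P \<inter> {y. normal v \<bullet> y = normal v \<bullet> \<omega> \<Lambda>}"
  have "z \<in> P" using assms(1) rel_interior_subset by blast
  have "?F face_of P"
    by (rule face_of_Int_supporting_hyperplane_ge[OF convex_convex_hull normal_le[OF assms(2,3)]])
  obtain \<Lambda>' where \<Lambda>': "\<Lambda>' \<in> A" "flips \<Lambda> v \<Lambda>'" using flip_exists[OF assms(2,3)] .
  have "v \<notin> V \<Lambda>'" using flipsE[OF \<Lambda>'(2)] assms(3) by (metis Diff_iff insertE singletonI)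
  then have "\<omega> \<Lambda>' \<notin> ?F" using normal_eq_iff[OF assms(2) \<Lambda>'(1) assms(3)] by simp
  moreover have "\<omega> \<Lambda>' \<in> P" using \<Lambda>'(1) by (simp add: hull_inc)
  ultimately have "\<not> P \<subseteq> ?F" by blast
  then have "z \<notin> ?F"
    using subset_of_face_of[OF \<open>?F face_of P\<close> order_refl] assms(1) by blast
  then show ?thesis using \<open>z \<in> P\<close> normal_le[OF assms(2,3) \<open>z \<in> P\<close>] by simp
qed

text \<open>Brick vectors differ by vectors of \<open>W\<close>, and flipping each contact of one
  arrangement recovers its spanning arcs. So the polar lives in \<open>W\<close>.\<close>

lemma span_P_translated:
  assumes "z \<in> P" shows "span ((\<lambda>x. x - z) ` P) = W"
proof
  obtain \<Lambda> where \<Lambda>: "\<Lambda> \<in> A" using A_nonempty by blast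
  have "P \<subseteq> {x. (\<chi> i. 1) \<bullet> x = (\<chi> i. 1) \<bullet> \<omega> \<Lambda>}"
  proof (rule hull_minimal)
    show "\<omega> ` A \<subseteq> {x. (\<chi> i. 1) \<bullet> x = (\<chi> i. 1) \<bullet> \<omega> \<Lambda>}"
      using \<omega>_diff_in_W[OF \<Lambda>] by (auto simp: W_eq_hyperplane inner_diff_right)
  qed (rule convex_hyperplane)
  then have *: "(\<chi> i. 1) \<bullet> x = (\<chi> i. 1) \<bullet> \<omega> \<Lambda>" if "x \<in> P" for x using that by blast
  have "(\<lambda>x. x - z) ` P \<subseteq> W"
    using *[OF assms] by (auto simp: W_eq_hyperplane inner_diff_right *)
  then show "span ((\<lambda>x. x - z) ` P) \<subseteq> W" using subspace_W by (rule span_minimal)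
  have "arc_vec \<Lambda> v \<in> span ((\<lambda>x. x - z) ` P)" if v: "v \<in> V \<Lambda>" for v
  proof -
    obtain \<Lambda>' where \<Lambda>': "\<Lambda>' \<in> A" "flips \<Lambda> v \<Lambda>'" using flip_exists[OF \<Lambda> v] .
    then obtain l where l: "0 < l" "\<omega> \<Lambda>' = \<omega> \<Lambda> + l *\<^sub>R arc_vec \<Lambda> v" unfolding flips_def by blast
    have *: "\<omega> M - z \<in> span ((\<lambda>x. x - z) ` P)" if "M \<in> A" for M
      using that by (intro span_base imageI hull_inc)
    have "arc_vec \<Lambda> v = (1 / l) *\<^sub>R ((\<omega> \<Lambda>' - z) - (\<omega> \<Lambda> - z))" using l by simp
    then show ?thesis using span_scale[OF span_diff[OF *[OF \<Lambda>'(1)] *[OF \<Lambda>]]] by metis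
  qed
  then have "span (arc_vec \<Lambda> ` V \<Lambda>) \<subseteq> span ((\<lambda>x. x - z) ` P)"
    by (intro span_minimal) auto
  then show "W \<subseteq> span ((\<lambda>x. x - z) ` P)" by (simp add: span_arcs[OF \<Lambda>])
qed

section \<open>Rays of the fan as vertices of the polar\<close>

context
  fixes z assumes z: "z \<in> rel_interior P"
begin

definition polarP :: "(real, 'n) vec set" where
  "polarP = {y \<in> W. \<forall>\<Lambda>\<in>A. y \<bullet> (\<omega> \<Lambda> - z) \<le> 1}"

text \<open>The slack of \<open>z\<close> in the facet inequality of \<open>v\<close>; by
  \<open>facet_value\<close> the choice of the arrangement does not matter.\<close>

definition height :: "'v \<Rightarrow> real" where
  "height v = normal v \<bullet> z - normal v \<bullet> \<omega> (SOME \<Lambda>. \<Lambda> \<in> A \<and> v \<in> V \<Lambda>)"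

text \<open>The facet inequality of \<open>v\<close> bounds \<open>normal v\<close> from below;
  divided by the slack at \<open>z\<close> it reads \<open>ray v \<bullet> (y - z) \<le> 1\<close>,
  whence the sign.\<close>

definition ray :: "'v \<Rightarrow> (real, 'n) vec" where
  "ray v = - (1 / height v) *\<^sub>R normal v"

lemma polar_about_eq: "polar_about z P = polarP"
proof -
  have "z \<in> P" using z rel_interior_subset by blast
  have "(\<forall>x\<in>P. y \<bullet> (x - z) \<le> 1) \<longleftrightarrow> (\<forall>\<Lambda>\<in>A. y \<bullet> (\<omega> \<Lambda> - z) \<le> 1)" for y
  proof
    assume "\<forall>\<Lambda>\<in>A. y \<bullet> (\<omega> \<Lambda> - z) \<le> 1"
    then have "\<omega> ` A \<subseteq> {x. y \<bullet> x \<le> 1 + y \<bullet> z}" by (auto simp: inner_diff_right algebra_simps)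
    then have "P \<subseteq> {x. y \<bullet> x \<le> 1 + y \<bullet> z}" by (rule hull_minimal) (rule convex_halfspace_le)
    then show "\<forall>x\<in>P. y \<bullet> (x - z) \<le> 1" by (auto simp: inner_diff_right algebra_simps)
  qed (simp add: hull_inc)
  then show ?thesis by (simp add: polar_about_def polarP_def span_P_translated[OF \<open>z \<in> P\<close>])
qed

lemma height_eq: assumes "\<Lambda> \<in> A" "v \<in> V \<Lambda>" shows "height v = normal v \<bullet> z - normal v \<bullet> \<omega> \<Lambda>"
proof -
  have "(SOME \<Lambda>. \<Lambda> \<in> A \<and> v \<in> V \<Lambda>) \<in> A \<and> v \<in> V (SOME \<Lambda>. \<Lambda> \<in> A \<and> v \<in> V \<Lambda>)"
    by (rule someI[of "\<lambda>\<Lambda>. \<Lambda> \<in> A \<and> v \<in> V \<Lambda>" \<Lambda>]) (use assms in simp)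
  then show ?thesis unfolding height_def using facet_value[OF assms(1) _ assms(2)] by simp
qed

lemma height_pos: assumes "\<Lambda> \<in> A" "v \<in> V \<Lambda>" shows "0 < height v"
  using normal_less_rel_interior[OF z assms] by (simp add: height_eq[OF assms])

lemma inner_ray_le:
  assumes "\<Lambda> \<in> A" "v \<in> V \<Lambda>" "M \<in> A"
  shows "ray v \<bullet> (\<omega> M - z) \<le> 1" and "ray v \<bullet> (\<omega> M - z) = 1 \<longleftrightarrow> v \<in> V M"
proof -
  have *: "ray v \<bullet> (\<omega> M - z) = (normal v \<bullet> z - normal v \<bullet> \<omega> M) / height v"
    by (simp add: ray_def inner_diff_right diff_divide_distrib)
  have le: "normal v \<bullet> z - normal v \<bullet> \<omega> M \<le> height v"
    using normal_le[OF assms(1,2), of "\<omega> M"] assms(3) by (simp add: height_eq[OF assms(1,2)] hull_inc)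
  then show "ray v \<bullet> (\<omega> M - z) \<le> 1" using height_pos[OF assms(1,2)] by (simp add: *)
  have "ray v \<bullet> (\<omega> M - z) = 1 \<longleftrightarrow> normal v \<bullet> z - normal v \<bullet> \<omega> M = height v"
    using height_pos[OF assms(1,2)] by (auto simp: *)
  also have "\<dots> \<longleftrightarrow> v \<in> V M"
    using normal_eq_iff[OF assms(1,3,2)] by (simp add: height_eq[OF assms(1,2)])
  finally show "ray v \<bullet> (\<omega> M - z) = 1 \<longleftrightarrow> v \<in> V M" .
qed

lemma ray_in_W: "\<Lambda> \<in> A \<Longrightarrow> v \<in> V \<Lambda> \<Longrightarrow> ray v \<in> W"
  unfolding ray_def using subspace_scale[OF subspace_W normal_in_W] .

lemma ray_in_polarP: "\<Lambda> \<in> A \<Longrightarrow> v \<in> V \<Lambda> \<Longrightarrow> ray v \<in> polarP"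
  by (auto simp: polarP_def ray_in_W inner_ray_le)

text \<open>Completeness of the fan: an arrangement minimizing \<open>- x\<close> has only
  nonnegative arcs for \<open>- x\<close>, so \<open>- x\<close> is a nonnegative combination of its
  normals. The sign is absorbed by \<open>ray\<close>.\<close>

lemma ray_expansion:
  assumes "x \<in> W"
  shows "\<exists>\<Lambda>\<in>A. \<exists>\<alpha>. (\<forall>v\<in>V \<Lambda>. 0 \<le> \<alpha> v) \<and> x = (\<Sum>v\<in>V \<Lambda>. \<alpha> v *\<^sub>R ray v)"
proof -
  obtain \<Lambda> where \<Lambda>: "\<Lambda> \<in> A" "\<And>M. M \<in> A \<Longrightarrow> (- x) \<bullet> \<omega> \<Lambda> \<le> (- x) \<bullet> \<omega> M"
    using exists_minimizer[of "- x"] by blast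
  let ?\<alpha> = "\<lambda>v. ((- x) \<bullet> arc_vec \<Lambda> v) * height v"
  have "0 \<le> ?\<alpha> v" if "v \<in> V \<Lambda>" for v
    using minimizer_inner_arc[OF \<Lambda> that] height_pos[OF \<Lambda>(1) that] by (intro mult_nonneg_nonneg) auto
  moreover have "x = (\<Sum>v\<in>V \<Lambda>. ?\<alpha> v *\<^sub>R ray v)"
  proof -
    have "x = (\<Sum>v\<in>V \<Lambda>. (x \<bullet> arc_vec \<Lambda> v) *\<^sub>R normal v)" by (rule normal_expansion[OF \<Lambda>(1) assms])
    also have "\<dots> = (\<Sum>v\<in>V \<Lambda>. ?\<alpha> v *\<^sub>R ray v)"
      using height_pos[OF \<Lambda>(1)] by (intro sum.cong) (auto simp: ray_def less_imp_neq[THEN not_sym])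
    finally show ?thesis .
  qed
  ultimately show ?thesis using \<Lambda>(1) by (intro bexI[of _ \<Lambda>] exI[of _ ?\<alpha>]) auto
qed

lemma inner_ray_arc:
  assumes "\<Lambda> \<in> A" "v \<in> V \<Lambda>" "u \<in> V \<Lambda>"
  shows "ray v \<bullet> arc_vec \<Lambda> u = (if u = v then - (1 / height v) else 0)"
  by (simp add: ray_def inner_normal_arc[OF assms])

text \<open>A ray is tight exactly at the arrangements containing its commutator, so equal rays put
  \<open>u\<close> and \<open>v\<close> into one arrangement, where an arc tells them apart.\<close>

lemma inj_on_ray: "inj_on ray (\<Union>\<Delta>)"
proof (rule inj_onI)
  fix u v assume "u \<in> \<Union>\<Delta>" "v \<in> \<Union>\<Delta>" and eq: "ray u = ray v"
  then obtain \<Lambda> M where \<Lambda>: "\<Lambda> \<in> A" "u \<in> V \<Lambda>" and M: "M \<in> A" "v \<in> V M" by (auto simp: \<Delta>_def)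
  have "ray v \<bullet> (\<omega> \<Lambda> - z) = 1" using inner_ray_le(2)[OF \<Lambda> \<Lambda>(1)] \<Lambda>(2) eq by simp
  then have v: "v \<in> V \<Lambda>" using inner_ray_le(2)[OF M \<Lambda>(1)] by blast
  have "ray u \<bullet> arc_vec \<Lambda> u \<noteq> 0" using inner_ray_arc[OF \<Lambda> \<Lambda>(2)] height_pos[OF \<Lambda>] by simp
  then have "ray v \<bullet> arc_vec \<Lambda> u \<noteq> 0" using eq by simp
  then show "u = v" using inner_ray_arc[OF \<Lambda>(1) v \<Lambda>(2)] by (simp split: if_splits)
qed

lemma affine_independent_rays:
  assumes "\<Lambda> \<in> A" "S \<subseteq> V \<Lambda>" shows "\<not> affine_dependent (ray ` S)"
proof -
  have fin: "finite S" using finite_V[OF assms(1)] assms(2) by (rule finite_subset[rotated])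
  have "S \<subseteq> \<Union>\<Delta>" using assms by (auto simp: \<Delta>_def)
  have "independent (ray ` S)"
  proof (rule independent_if_scalars_zero)
    fix f x assume f: "(\<Sum>x\<in>ray ` S. f x *\<^sub>R x) = 0" and "x \<in> ray ` S"
    then obtain u where u: "x = ray u" "u \<in> S" by blast
    have "(\<Sum>v\<in>S. f (ray v) *\<^sub>R ray v) = 0"
      using f by (simp add: sum.reindex[OF inj_on_subset[OF inj_on_ray \<open>S \<subseteq> \<Union>\<Delta>\<close>]])
    then have "0 = (\<Sum>v\<in>S. f (ray v) *\<^sub>R ray v) \<bullet> arc_vec \<Lambda> u" by simp
    also have "\<dots> = (\<Sum>v\<in>S. if u = v then f (ray v) * - (1 / height v) else 0)"
      unfolding inner_sum_left using assms u
      by (intro sum.cong) (auto simp: inner_ray_arc[OF assms(1)] subset_iff)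
    also have "\<dots> = f (ray u) * - (1 / height u)" using fin u(2) by simp
    finally show "f x = 0" using height_pos[OF assms(1), of u] u assms(2) by auto
  qed (use fin in simp)
  then show ?thesis using affine_dependent_imp_dependent by blast
qed

lemma convex_polarP: "convex polarP"
proof -
  have "polarP = W \<inter> (\<Inter>\<Lambda>\<in>A. {y. (\<omega> \<Lambda> - z) \<bullet> y \<le> 1})"
    by (auto simp: polarP_def inner_commute)
  also have "convex \<dots>"
    by (intro convex_Int convex_INT convex_halfspace_le subspace_imp_convex subspace_W)
  finally show ?thesis .
qed

section \<open>Faces of the polar\<close>

definition ray_face :: "'v set \<Rightarrow> (real, 'n) vec set" where
  "ray_face S = convex hull (ray ` S)"

text \<open>The bound is attained at \<open>M = \<Lambda>\<close>, so the total weight is the gauge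
  of the polar at this point; the equality case tells which inequalities of the polar are tight when
  the weight is 1.\<close>

lemma inner_ray_sum_le:
  assumes "\<Lambda> \<in> A" "\<And>v. v \<in> V \<Lambda> \<Longrightarrow> 0 \<le> \<alpha> v" "M \<in> A"
  shows "(\<Sum>v\<in>V \<Lambda>. \<alpha> v *\<^sub>R ray v) \<bullet> (\<omega> M - z) \<le> sum \<alpha> (V \<Lambda>)"
    and "(\<Sum>v\<in>V \<Lambda>. \<alpha> v *\<^sub>R ray v) \<bullet> (\<omega> M - z) = sum \<alpha> (V \<Lambda>) \<longleftrightarrow> {v\<in>V \<Lambda>. \<alpha> v \<noteq> 0} \<subseteq> V M"
proof -
  let ?l = "\<lambda>v. \<alpha> v * (ray v \<bullet> (\<omega> M - z))"
  have eq: "(\<Sum>v\<in>V \<Lambda>. \<alpha> v *\<^sub>R ray v) \<bullet> (\<omega> M - z) = sum ?l (V \<Lambda>)"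
    by (simp add: inner_sum_left)
  have le: "?l v \<le> \<alpha> v" if "v \<in> V \<Lambda>" for v
    using mult_left_mono[OF inner_ray_le(1)[OF assms(1) that assms(3)] assms(2)[OF that]] by simp
  then show "(\<Sum>v\<in>V \<Lambda>. \<alpha> v *\<^sub>R ray v) \<bullet> (\<omega> M - z) \<le> sum \<alpha> (V \<Lambda>)"
    unfolding eq by (rule sum_mono)
  have "sum ?l (V \<Lambda>) = sum \<alpha> (V \<Lambda>) \<longleftrightarrow> (\<Sum>v\<in>V \<Lambda>. \<alpha> v - ?l v) = 0"
    by (simp add: sum_subtractf) (metis)
  also have "\<dots> \<longleftrightarrow> (\<forall>v\<in>V \<Lambda>. \<alpha> v - ?l v = 0)"
    using le finite_V[OF assms(1)] by (intro sum_nonneg_eq_0_iff) auto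
  also have "\<dots> \<longleftrightarrow> {v\<in>V \<Lambda>. \<alpha> v \<noteq> 0} \<subseteq> V M"
    using inner_ray_le(2)[OF assms(1) _ assms(3)] by auto
  finally show "(\<Sum>v\<in>V \<Lambda>. \<alpha> v *\<^sub>R ray v) \<bullet> (\<omega> M - z) = sum \<alpha> (V \<Lambda>) \<longleftrightarrow> {v\<in>V \<Lambda>. \<alpha> v \<noteq> 0} \<subseteq> V M"
    unfolding eq .
qed

lemma ray_sum_in_ray_face:
  assumes "\<Lambda> \<in> A" "\<And>v. v \<in> V \<Lambda> \<Longrightarrow> 0 \<le> \<alpha> v" "sum \<alpha> (V \<Lambda>) = 1" "{v\<in>V \<Lambda>. \<alpha> v \<noteq> 0} \<subseteq> S"
  shows "(\<Sum>v\<in>V \<Lambda>. \<alpha> v *\<^sub>R ray v) \<in> ray_face S"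
proof -
  let ?T = "{v\<in>V \<Lambda>. \<alpha> v \<noteq> 0}"
  have "(\<Sum>v\<in>V \<Lambda>. \<alpha> v *\<^sub>R ray v) = (\<Sum>v\<in>?T. \<alpha> v *\<^sub>R ray v)" "sum \<alpha> (V \<Lambda>) = sum \<alpha> ?T"
    using finite_V[OF assms(1)] by (auto intro!: sum.mono_neutral_right)
  moreover have "(\<Sum>v\<in>?T. \<alpha> v *\<^sub>R ray v) \<in> ray_face S" unfolding ray_face_def
    by (rule convex_sum)
      (use assms finite_V[OF assms(1)] \<open>sum \<alpha> (V \<Lambda>) = sum \<alpha> ?T\<close> in \<open>auto intro: hull_inc\<close>)
  ultimately show ?thesis by simp
qed

text \<open>A point of the right side, expanded in the rays of some \<open>M\<close>, has total
  weight 1, and its nonzero weights sit on contacts common to the whole star of \<open>S\<close>.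
  These are only the elements of \<open>S\<close>, as any other contact of \<Lambda> can be flipped
  away within the star.\<close>

lemma ray_face_eq:
  assumes "\<Lambda> \<in> A" "S \<subseteq> V \<Lambda>"
  shows "ray_face S = (\<Inter>M\<in>{M \<in> A. S \<subseteq> V M}. polarP \<inter> {y. (\<omega> M - z) \<bullet> y = 1})" (is "_ = ?R")
proof
  show "ray_face S \<subseteq> ?R" unfolding ray_face_def
  proof (rule hull_minimal)
    show "ray ` S \<subseteq> ?R"
      using assms ray_in_polarP inner_ray_le(2)[OF assms(1)] by (auto simp: inner_commute[of "_ - z"] subset_iff)
    show "convex ?R" by (intro convex_INT convex_Int convex_polarP convex_hyperplane)
  qed
  show "?R \<subseteq> ray_face S"
  proof
    fix x assume x: "x \<in> ?R"
    then have "x \<in> polarP" using assms by blast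
    then have "x \<in> W" by (simp add: polarP_def)
    obtain M \<alpha> where M: "M \<in> A" "\<And>v. v \<in> V M \<Longrightarrow> 0 \<le> \<alpha> v" "x = (\<Sum>v\<in>V M. \<alpha> v *\<^sub>R ray v)"
      using ray_expansion[OF \<open>x \<in> W\<close>] by blast
    have "x \<bullet> (\<omega> M - z) = sum \<alpha> (V M)" unfolding M(3) using inner_ray_sum_le(2)[OF M(1,2,1)] by simp
    then have le: "sum \<alpha> (V M) \<le> 1" using \<open>x \<in> polarP\<close> M(1) by (auto simp: polarP_def)
    have 1: "x \<bullet> (\<omega> L - z) = 1" if "L \<in> A" "S \<subseteq> V L" for L
    proof -
      have "x \<in> polarP \<inter> {y. (\<omega> L - z) \<bullet> y = 1}" using x that by blast
      then show ?thesis by (simp add: inner_commute)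
    qed
    have ge: "1 \<le> sum \<alpha> (V M)"
      using 1[OF assms] inner_ray_sum_le(1)[where \<alpha> = \<alpha>, OF M(1,2) assms(1)] unfolding M(3) by simp
    have supp: "{v\<in>V M. \<alpha> v \<noteq> 0} \<subseteq> V L" if "L \<in> A" "S \<subseteq> V L" for L
      using 1[OF that] inner_ray_sum_le(2)[where \<alpha> = \<alpha>, OF M(1,2) that(1)] le ge unfolding M(3) by simp
    have "{v\<in>V M. \<alpha> v \<noteq> 0} \<subseteq> S"
    proof (rule ccontr)
      assume "\<not> {v\<in>V M. \<alpha> v \<noteq> 0} \<subseteq> S"
      then obtain u where u: "u \<in> {v\<in>V M. \<alpha> v \<noteq> 0}" "u \<notin> S" by blast
      then have "u \<in> V \<Lambda>" using supp[OF assms] by blast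
      obtain \<Lambda>' where \<Lambda>': "\<Lambda>' \<in> A" "flips \<Lambda> u \<Lambda>'" using flip_exists[OF assms(1) \<open>u \<in> V \<Lambda>\<close>] .
      have "u \<notin> V \<Lambda>'" using flipsE[OF \<Lambda>'(2)] \<open>u \<in> V \<Lambda>\<close> by (metis Diff_iff insertE singletonI)
      then show False using supp[OF \<Lambda>'(1)] flips_keep[OF \<Lambda>'(2) assms(2) u(2)] u(1) by blast
    qed
    then show "x \<in> ray_face S" unfolding M(3)
      using ray_sum_in_ray_face[OF M(1,2)] le ge by simp
  qed
qed

lemma ray_face_face:
  assumes "S \<in> \<Delta>" shows "ray_face S face_of polarP" and "ray_face S \<noteq> polarP"
proof -
  obtain \<Lambda> where \<Lambda>: "\<Lambda> \<in> A" "S \<subseteq> V \<Lambda>" using assms by (auto simp: \<Delta>_def)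
  have "(polarP \<inter> {y. (\<omega> M - z) \<bullet> y = 1}) face_of polarP" if "M \<in> A" for M
    by (rule face_of_Int_supporting_hyperplane_le[OF convex_polarP])
      (use that in \<open>auto simp: polarP_def inner_commute\<close>)
  then show "ray_face S face_of polarP"
    unfolding ray_face_eq[OF \<Lambda>] using \<Lambda> by (intro face_of_Inter) auto
  have "0 \<in> polarP" by (simp add: polarP_def subspace_0 subspace_W)
  moreover have "0 \<notin> ray_face S" unfolding ray_face_eq[OF \<Lambda>] using \<Lambda> by auto
  ultimately show "ray_face S \<noteq> polarP" by blast
qed

text \<open>A relative interior point \<open>x\<close> of \<open>F\<close> is expanded in rays.
  Total weight below 1 would let every segment from a point of the polar to \<open>x\<close> be
  prolonged beyond \<open>x\<close>, forcing \<open>F\<close> to be everything. With weight 1,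
  \<open>x\<close> is also in the relative interior of a ray face, and two faces sharing a relative
  interior point coincide.\<close>

lemma proper_face_is_ray_face:
  assumes F: "F face_of polarP" "F \<noteq> polarP" "F \<noteq> {}"
  obtains S where "S \<in> \<Delta>" "F = ray_face S"
proof -
  obtain x where x: "x \<in> rel_interior F"
    using rel_interior_eq_empty[OF face_of_imp_convex[OF F(1)]] F(3) by blast
  then have "x \<in> F" using rel_interior_subset by blast
  then have "x \<in> polarP" using face_of_imp_subset[OF F(1)] by blast
  then have "x \<in> W" by (simp add: polarP_def)
  obtain \<Lambda> \<alpha> where \<Lambda>: "\<Lambda> \<in> A" and \<alpha>: "\<And>v. v \<in> V \<Lambda> \<Longrightarrow> 0 \<le> \<alpha> v"
    and x_eq: "x = (\<Sum>v\<in>V \<Lambda>. \<alpha> v *\<^sub>R ray v)"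
    using ray_expansion[OF \<open>x \<in> W\<close>] by blast
  have "x \<bullet> (\<omega> \<Lambda> - z) = sum \<alpha> (V \<Lambda>)" unfolding x_eq using inner_ray_sum_le(2)[OF \<Lambda> \<alpha> \<Lambda>] by simp
  then have le: "sum \<alpha> (V \<Lambda>) \<le> 1" using \<open>x \<in> polarP\<close> \<Lambda> by (auto simp: polarP_def)
  have sum_1: "sum \<alpha> (V \<Lambda>) = 1"
  proof (rule ccontr)
    assume "sum \<alpha> (V \<Lambda>) \<noteq> 1"
    define s where "s = sum \<alpha> (V \<Lambda>)"
    have s: "0 \<le> s" "s < 1" using le \<open>sum \<alpha> (V \<Lambda>) \<noteq> 1\<close> sum_nonneg[of "V \<Lambda>" \<alpha>] \<alpha> by (auto simp: s_def)
    have "q \<in> F" if q: "q \<in> polarP" for q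
    proof (cases "q = x")
      case False
      define K where "K = (\<Sum>M\<in>A. \<bar>q \<bullet> (\<omega> M - z)\<bar>)"
      \<comment> \<open>The prolonged point has inner products at most
        \<open>(1 + e) * s + e * K\<close>, which is at most 1 as soon as
        \<open>e * (s + K) \<le> 1 - s\<close>. The summand 1 keeps the denominator
        positive.\<close>
      define e where "e = (1 - s) / (s + K + 1)"
      have "0 \<le> K" unfolding K_def by (rule sum_nonneg) simp
      then have "0 < e" using s by (simp add: e_def)
      define y where "y = x - e *\<^sub>R (q - x)"
      have "y \<bullet> (\<omega> M - z) \<le> 1" if "M \<in> A" for M
      proof -
        have "\<bar>q \<bullet> (\<omega> M - z)\<bar> \<le> K" unfolding K_def by (rule member_le_sum) (use that finite_A in auto)
        then have "- (q \<bullet> (\<omega> M - z)) \<le> K" by simp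
        then have "e * (- (q \<bullet> (\<omega> M - z))) \<le> e * K" using \<open>0 < e\<close> by (intro mult_left_mono) auto
        moreover have "x \<bullet> (\<omega> M - z) \<le> s"
          unfolding x_eq s_def by (rule inner_ray_sum_le(1)[OF \<Lambda> \<alpha> that])
        then have "(1 + e) * (x \<bullet> (\<omega> M - z)) \<le> (1 + e) * s" using \<open>0 < e\<close> by (intro mult_left_mono) auto
        moreover have "y \<bullet> (\<omega> M - z) = (1 + e) * (x \<bullet> (\<omega> M - z)) + e * (- (q \<bullet> (\<omega> M - z)))"
          unfolding y_def by (simp only: inner_diff_left inner_scaleR_left) (simp add: algebra_simps)
        moreover have "e * (s + K) \<le> 1 - s"
        proof -
          have "e * (s + K) \<le> e * (s + K + 1)" using \<open>0 < e\<close> by (intro mult_left_mono) auto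
          also have "\<dots> = 1 - s" using s \<open>0 \<le> K\<close> by (simp add: e_def)
          finally show ?thesis .
        qed
        ultimately show ?thesis by (simp add: algebra_simps)
      qed
      moreover have "y \<in> W" using \<open>x \<in> polarP\<close> q unfolding y_def polarP_def
        by (intro subspace_diff[OF subspace_W] subspace_scale[OF subspace_W]) auto
      ultimately have "y \<in> polarP" by (simp add: polarP_def)
      have "x = (1 - e / (1 + e)) *\<^sub>R y + (e / (1 + e)) *\<^sub>R q"
      proof -
        have "(1 - e / (1 + e)) * (1 + e) = 1" "(1 - e / (1 + e)) * e = e / (1 + e)"
          using \<open>0 < e\<close> by (simp_all add: field_simps)
        moreover have "y = (1 + e) *\<^sub>R x - e *\<^sub>R q" by (simp add: y_def algebra_simps)
        ultimately show ?thesis by (simp add: scaleR_diff_right)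
      qed
      moreover have "y \<noteq> q"
      proof
        assume "y = q"
        then have "(1 + e) *\<^sub>R (q - x) = 0" by (simp add: y_def algebra_simps)
        then show False using False \<open>0 < e\<close> by simp
      qed
      ultimately have "x \<in> open_segment y q"
        using \<open>0 < e\<close> unfolding in_segment(2) by (intro conjI exI[of _ "e / (1 + e)"]) auto
      then show ?thesis using face_ofD[OF F(1) _ \<open>y \<in> polarP\<close> q \<open>x \<in> F\<close>] by blast
    qed (use \<open>x \<in> F\<close> in simp)
    then show False using F(2) face_of_imp_subset[OF F(1)] by blast
  qed
  define S where "S = {v\<in>V \<Lambda>. \<alpha> v \<noteq> 0}"
  have S: "S \<subseteq> V \<Lambda>" "S \<in> \<Delta>" using \<Lambda> by (auto simp: S_def \<Delta>_def)
  have fin: "finite S" using finite_V[OF \<Lambda>] by (simp add: S_def)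
  have "x \<in> ray_face S" unfolding x_eq
    by (rule ray_sum_in_ray_face[OF \<Lambda> \<alpha> sum_1]) (simp_all add: S_def)
  then have "F \<subseteq> ray_face S"
    using subset_of_face_of[OF ray_face_face(1)[OF S(2)] face_of_imp_subset[OF F(1)]] x by blast
  moreover have "x \<in> rel_interior (ray_face S)"
  proof -
    have inj: "inj_on ray S" by (rule inj_on_subset[OF inj_on_ray]) (use S(2) in blast)
    have x': "x = (\<Sum>v\<in>S. \<alpha> v *\<^sub>R ray v)"
      unfolding x_eq S_def using finite_V[OF \<Lambda>] by (auto intro!: sum.mono_neutral_right)
    have sum_S: "sum \<alpha> S = 1"
      unfolding sum_1[symmetric] S_def using finite_V[OF \<Lambda>] by (auto intro!: sum.mono_neutral_left)
    \<comment> \<open>The explicit relative interior of a simplex wants positive weights on its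
      vertices, so the weights are carried from commutators to their rays.\<close>
    let ?c = "\<lambda>y. \<alpha> (the_inv_into S ray y)"
    have "0 < \<alpha> v" if "v \<in> S" for v using \<alpha>[of v] that by (auto simp: S_def less_le)
    then have "\<forall>y\<in>ray ` S. 0 < ?c y" by (simp add: the_inv_into_f_f[OF inj])
    moreover have "sum ?c (ray ` S) = 1"
      using sum_S by (simp add: sum.reindex[OF inj] the_inv_into_f_f[OF inj])
    moreover have "(\<Sum>y\<in>ray ` S. ?c y *\<^sub>R y) = x"
      unfolding x' by (simp add: sum.reindex[OF inj] the_inv_into_f_f[OF inj])
    ultimately show ?thesis
      unfolding ray_face_def rel_interior_convex_hull_explicit[OF affine_independent_rays[OF \<Lambda> S(1)]]
      by (intro CollectI exI[of _ ?c] conjI)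
  qed
  then have "ray_face S \<subseteq> F"
    using subset_of_face_of[OF F(1) face_of_imp_subset[OF ray_face_face(1)[OF S(2)]]] \<open>x \<in> F\<close> by blast
  ultimately show thesis using that S(2) by blast
qed

lemma boundary_complex_polarP: "boundary_complex polarP = ray_face ` \<Delta>"
proof
  show "ray_face ` \<Delta> \<subseteq> boundary_complex polarP"
    using ray_face_face by (auto simp: boundary_complex_def)
  show "boundary_complex polarP \<subseteq> ray_face ` \<Delta>"
  proof
    fix F assume "F \<in> boundary_complex polarP"
    then have F: "F face_of polarP" "F \<noteq> polarP" by (auto simp: boundary_complex_def)
    show "F \<in> ray_face ` \<Delta>"
    proof (cases "F = {}")
      case True
      have "{} \<in> \<Delta>" using A_nonempty by (auto simp: \<Delta>_def)
      then show ?thesis using True by (auto simp: ray_face_def intro!: image_eqI[of _ _ "{}"])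
    next
      case False
      then show ?thesis using proper_face_is_ray_face[OF F] by blast
    qed
  qed
qed

lemma extreme_points_ray_face:
  assumes "S \<in> \<Delta>" shows "{x. x extreme_point_of ray_face S} = ray ` S"
proof -
  obtain \<Lambda> where \<Lambda>: "\<Lambda> \<in> A" "S \<subseteq> V \<Lambda>" using assms by (auto simp: \<Delta>_def)
  show ?thesis unfolding ray_face_def
    using extreme_point_of_convex_hull_affine_independent[OF affine_independent_rays[OF \<Lambda>]] by simp
qed

lemma finite_\<Delta>: "finite \<Delta>"
proof -
  have "\<Delta> \<subseteq> (\<Union>\<Lambda>\<in>A. Pow (V \<Lambda>))" by (auto simp: \<Delta>_def)
  then show ?thesis by (rule finite_subset) (simp add: finite_A finite_V)
qed

lemma simplicial_complex_polar: "simplicial_complex (boundary_complex (polar_about z P))"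
  unfolding simplicial_complex_def polar_about_eq
proof (intro conjI ballI allI impI; (elim conjE)?)
  show "finite (boundary_complex polarP)" by (simp add: boundary_complex_polarP finite_\<Delta>)
next
  fix F assume "F \<in> boundary_complex polarP"
  then obtain S where S: "S \<in> \<Delta>" "F = ray_face S" by (auto simp: boundary_complex_polarP)
  then obtain \<Lambda> where \<Lambda>: "\<Lambda> \<in> A" "S \<subseteq> V \<Lambda>" by (auto simp: \<Delta>_def)
  have "(int (card (ray ` S)) - 1) simplex F"
    unfolding S(2) ray_face_def using affine_independent_rays[OF \<Lambda>] by (intro simplex_convex_hull) simp
  then show "\<exists>n. n simplex F" ..
next
  fix F S assume S: "S \<in> boundary_complex polarP" "F face_of S"
  then have "F face_of polarP" using face_of_trans by (auto simp: boundary_complex_def)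
  moreover have "F \<noteq> polarP"
    using S face_of_imp_subset by (fastforce simp: boundary_complex_def)
  ultimately show "F \<in> boundary_complex polarP" by (simp add: boundary_complex_def)
next
  fix S T assume "S \<in> boundary_complex polarP" "T \<in> boundary_complex polarP"
  then have ST: "S face_of polarP" "T face_of polarP" by (auto simp: boundary_complex_def)
  show "S \<inter> T face_of S"
    using face_of_subset[OF face_of_Int[OF ST]] face_of_imp_subset[OF ST(1)] by blast
qed

lemma polar_iso: "simplicially_isomorphic \<Delta> (vertex_scheme (boundary_complex (polar_about z P)))"
proof -
  have scheme: "vertex_scheme (boundary_complex (polar_about z P)) = (`) ray ` \<Delta>"
    unfolding polar_about_eq boundary_complex_polarP vertex_scheme_def image_image
    by (rule image_cong) (simp_all add: extreme_points_ray_face)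
  have "bij_betw ray (\<Union>\<Delta>) (\<Union>((`) ray ` \<Delta>))"
    using inj_on_ray by (auto simp: bij_betw_def)
  moreover have "S \<in> \<Delta> \<longleftrightarrow> ray ` S \<in> (`) ray ` \<Delta>" if "S \<subseteq> \<Union>\<Delta>" for S
  proof
    assume "ray ` S \<in> (`) ray ` \<Delta>"
    then obtain T where T: "T \<in> \<Delta>" "ray ` S = ray ` T" by blast
    then have "S = T" using inj_on_image_eq_iff[OF inj_on_ray that] by blast
    then show "S \<in> \<Delta>" using T by simp
  qed simp
  ultimately show ?thesis unfolding simplicially_isomorphic_def scheme by blast
qed

end

end

section \<open>Pseudoline arrangements\<close>

text \<open>Undirected walks use arcs in both directions, hence an equivalence for each arc.\<close>

lemma reachable_mk_symmetric_induct:
  assumes "u \<rightarrow>\<^sup>*\<^bsub>with_proj (mk_symmetric G)\<^esub> v" "P u"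
    and "\<And>e. e \<in> arcs G \<Longrightarrow> P (tail G e) \<longleftrightarrow> P (head G e)"
  shows "P v"
  using assms(1,2) unfolding reachable_def
proof (induction rule: rtrancl_on.induct)
  case (rtrancl_on_into_rtrancl_on x v w)
  then have "(v, w) \<in> parcs (mk_symmetric G)" "P v" by simp_all
  then show ?case using assms(3) by (auto simp: mk_symmetric_def)
qed

locale pseudoline_network =
  fixes N :: "'n::{finite,linorder} network"
  assumes network: "network N"
begin

abbreviation lo :: "nat \<Rightarrow> 'n" where "lo k \<equiv> fst (N ! k)"
abbreviation hi :: "nat \<Rightarrow> 'n" where "hi k \<equiv> snd (N ! k)"
abbreviation m :: nat where "m \<equiv> length N"
abbreviation swap :: "nat \<Rightarrow> 'n \<Rightarrow> 'n" where "swap k \<equiv> Transposition.transpose (lo k) (hi k)"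

lemma lo_less_hi: "k < m \<Longrightarrow> lo k < hi k"
  and no_level_between: "k < m \<Longrightarrow> \<not> (\<exists>d. lo k < d \<and> d < hi k)"
proof -
  assume "k < m"
  then have "N ! k \<in> set N" by simp
  then have "case N ! k of (a, b) \<Rightarrow> a < b \<and> \<not> (\<exists>d. a < d \<and> d < b)"
    using network unfolding network_def by (rule bspec[rotated])
  then show "lo k < hi k" "\<not> (\<exists>d. lo k < d \<and> d < hi k)" by (simp_all add: case_prod_unfold)
qed

text \<open>Since levels joined by a commutator are consecutive, the upper one determines the lower;
  bricks can thus be handled by \<open>hi\<close> alone.\<close>

lemma lo_eq_if_hi_eq:
  assumes "k < m" "t < m" "hi k = hi t" shows "N ! k = N ! t"
proof -
  have "lo k = lo t"
    using assms lo_less_hi[OF assms(1)] lo_less_hi[OF assms(2)] no_level_between[OF assms(1)]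
      no_level_between[OF assms(2)] by (metis neqE)
  then show ?thesis using assms(3) by (rule prod_eqI)
qed

lemma swap_less:
  assumes "k < m" "{l, l'} \<noteq> {lo k, hi k}" shows "swap k l < swap k l' \<longleftrightarrow> l < l'"
  using adjacent_transpose_less[of id "lo k" "hi k" l l'] lo_less_hi[OF assms(1)]
    no_level_between[OF assms(1)] assms(2)
  by (auto simp: transpose_commute[of "hi k"] insert_commute[of "hi k"])

lemma crossing_commute: "crossing N p q k \<longleftrightarrow> crossing N q p k"
  by (auto simp: crossing_def)

section \<open>Levels, crossings and contacts of one arrangement\<close>

context
  fixes \<Lambda> assumes \<Lambda>: "\<Lambda> \<in> arr N"
begin

lemma length_line: "length (\<Lambda> i) = m + 1"
  and line_start: "\<Lambda> i ! 0 = i"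
  and line_step: "k < m \<Longrightarrow> \<Lambda> i ! (k + 1) = \<Lambda> i ! k \<or> {\<Lambda> i ! k, \<Lambda> i ! (k + 1)} = {lo k, hi k}"
  using \<Lambda> unfolding arr_def pseudoline_def by blast+

lemma lines_distinct: "i \<noteq> j \<Longrightarrow> k \<le> m \<Longrightarrow> \<Lambda> i ! k \<noteq> \<Lambda> j ! k"
  and ex1_crossing: "i \<noteq> j \<Longrightarrow> \<exists>!k. crossing N (\<Lambda> i) (\<Lambda> j) k"
  using \<Lambda> unfolding arr_def by blast+

lemma inj_level: "k \<le> m \<Longrightarrow> inj (\<lambda>i. \<Lambda> i ! k)"
  using lines_distinct by (auto intro: injI)

lemma ex_line_at: assumes "k \<le> m" obtains i where "\<Lambda> i ! k = l"
proof -
  have "surj (\<lambda>i. \<Lambda> i ! k)"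
    using inj_level[OF assms] by (rule finite_UNIV_inj_surj[rotated]) simp
  then have "l \<in> range (\<lambda>i. \<Lambda> i ! k)" by simp
  then show thesis using that by blast
qed

lemma level_eq_iff: "k \<le> m \<Longrightarrow> \<Lambda> i ! k = \<Lambda> j ! k \<longleftrightarrow> i = j"
  using lines_distinct by blast

lemma the_line_at: "k \<le> m \<Longrightarrow> \<Lambda> i ! k = l \<Longrightarrow> (THE i. \<Lambda> i ! k = l) = i"
  using level_eq_iff by (intro the_equality) auto

text \<open>Each level carries exactly one line before and after \<open>k\<close>. If one line
  traverses \<open>k\<close>, the line at the other end is displaced and must traverse it as well.
  So every commutator is either a crossing or a contact.\<close>

lemma traversing_step:
  assumes "k < m" "traverses (\<Lambda> x) k"
  shows "\<Lambda> i ! (k + 1) = swap k (\<Lambda> i ! k)" and "k \<notin> contacts N \<Lambda>"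
proof -
  have x: "{\<Lambda> x ! k, \<Lambda> x ! (k + 1)} = {lo k, hi k}" "\<Lambda> x ! (k + 1) \<noteq> \<Lambda> x ! k"
    using line_step[OF assms(1), of x] assms(2) by (auto simp: traverses_def)
  obtain y where y: "\<Lambda> y ! k = \<Lambda> x ! (k + 1)" using ex_line_at[of k] assms(1) by auto
  have "y \<noteq> x" using x y by auto
  then have "\<Lambda> y ! (k + 1) \<noteq> \<Lambda> x ! (k + 1)" using lines_distinct[of y x "k + 1"] assms(1) by simp
  then have y': "\<Lambda> y ! (k + 1) = \<Lambda> x ! k"
    using line_step[OF assms(1), of y] x y by (auto simp: doubleton_eq_iff)
  have other: "\<Lambda> i ! k \<notin> {lo k, hi k}" if "i \<noteq> x" "i \<noteq> y" for i
    using that lines_distinct[of i x k] lines_distinct[of i y k] assms(1) x y by auto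
  show "\<Lambda> i ! (k + 1) = swap k (\<Lambda> i ! k)"
  proof (cases "i = x \<or> i = y")
    case True
    then show ?thesis using x y y' by (auto simp: doubleton_eq_iff)
  next
    case False
    then have "\<Lambda> i ! (k + 1) = \<Lambda> i ! k" using other[of i] line_step[OF assms(1), of i] by (auto simp: doubleton_eq_iff)
    moreover have "swap k (\<Lambda> i ! k) = \<Lambda> i ! k" using other[of i] False by (simp add: transpose_apply_other)
    ultimately show ?thesis by simp
  qed
  show "k \<notin> contacts N \<Lambda>"
  proof
    assume "k \<in> contacts N \<Lambda>"
    then obtain i j where ij: "i \<noteq> j" "\<not> traverses (\<Lambda> i) k" "\<not> traverses (\<Lambda> j) k" "{\<Lambda> i ! k, \<Lambda> j ! k} = {lo k, hi k}"
      unfolding contacts_def contact_def by blast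
    have "i \<in> {x, y}" "j \<in> {x, y}" using other ij(4) by blast+
    then show False using ij(1-3) assms(2) by auto
  qed
qed

lemma contacts_iff: "k \<in> contacts N \<Lambda> \<longleftrightarrow> k < m \<and> (\<forall>x. \<not> traverses (\<Lambda> x) k)"
proof
  assume "k \<in> contacts N \<Lambda>"
  moreover from this have "k < m" unfolding contacts_def contact_def by blast
  ultimately show "k < m \<and> (\<forall>x. \<not> traverses (\<Lambda> x) k)" using traversing_step(2) by blast
next
  assume k: "k < m \<and> (\<forall>x. \<not> traverses (\<Lambda> x) k)"
  obtain i where i: "\<Lambda> i ! k = lo k" using ex_line_at[of k] k by auto
  obtain j where j: "\<Lambda> j ! k = hi k" using ex_line_at[of k] k by auto
  have "i \<noteq> j" using i j lo_less_hi[of k] k by auto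
  moreover have "contact N (\<Lambda> i) (\<Lambda> j) k" using k by (simp add: contact_def i j)
  ultimately show "k \<in> contacts N \<Lambda>" unfolding contacts_def by blast
qed

lemma contacts_less: "k \<in> contacts N \<Lambda> \<Longrightarrow> k < m"
  by (simp add: contacts_iff)

lemma contact_step: "k \<in> contacts N \<Lambda> \<Longrightarrow> \<Lambda> i ! (k + 1) = \<Lambda> i ! k"
  by (simp add: contacts_iff traverses_def)

lemma cross_step: "k < m \<Longrightarrow> k \<notin> contacts N \<Lambda> \<Longrightarrow> \<Lambda> i ! (k + 1) = swap k (\<Lambda> i ! k)"
  using contacts_iff traversing_step(1) by blast

lemma traverses_iff:
  assumes "k < m"
  shows "traverses (\<Lambda> i) k \<longleftrightarrow> k \<notin> contacts N \<Lambda> \<and> \<Lambda> i ! k \<in> {lo k, hi k}"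
proof (cases "k \<in> contacts N \<Lambda>")
  case True
  then show ?thesis by (simp add: contacts_iff)
next
  case False
  then show ?thesis
    using lo_less_hi[OF assms] unfolding traverses_def cross_step[OF assms False]
    by (auto simp: Transposition.transpose_def)
qed

lemma crossing_iff:
  "crossing N (\<Lambda> i) (\<Lambda> j) k \<longleftrightarrow> k < m \<and> k \<notin> contacts N \<Lambda> \<and> \<Lambda> i ! k \<in> {lo k, hi k} \<and> \<Lambda> j ! k \<in> {lo k, hi k}"
  using traverses_iff[of k] by (auto simp: crossing_def)

lemma crossing_levels:
  assumes "i \<noteq> j" "crossing N (\<Lambda> i) (\<Lambda> j) k" shows "{\<Lambda> i ! k, \<Lambda> j ! k} = {lo k, hi k}"
  using assms lines_distinct[OF assms(1), of k] by (auto simp: crossing_iff)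

lemma contact_iff:
  "contact N (\<Lambda> i) (\<Lambda> j) k \<longleftrightarrow> k \<in> contacts N \<Lambda> \<and> {\<Lambda> i ! k, \<Lambda> j ! k} = {lo k, hi k}"
proof
  assume c: "contact N (\<Lambda> i) (\<Lambda> j) k"
  then have "i \<noteq> j" using lo_less_hi[of k] by (auto simp: contact_def)
  then show "k \<in> contacts N \<Lambda> \<and> {\<Lambda> i ! k, \<Lambda> j ! k} = {lo k, hi k}"
    using c by (auto simp: contacts_def contact_def)
qed (auto simp: contact_def contacts_iff)

lemma order_step:
  assumes "k < m" "i \<noteq> j"
  shows "\<Lambda> i ! (k + 1) < \<Lambda> j ! (k + 1) \<longleftrightarrow>
    (if crossing N (\<Lambda> i) (\<Lambda> j) k then \<Lambda> j ! k < \<Lambda> i ! k else \<Lambda> i ! k < \<Lambda> j ! k)"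
proof (cases "k \<in> contacts N \<Lambda>")
  case True
  then show ?thesis unfolding contact_step[OF True] by (simp add: crossing_iff)
next
  case False
  note step = cross_step[OF assms(1) False]
  show ?thesis
  proof (cases "{\<Lambda> i ! k, \<Lambda> j ! k} = {lo k, hi k}")
    case True
    then have "crossing N (\<Lambda> i) (\<Lambda> j) k" using False assms(1) by (auto simp: crossing_iff doubleton_eq_iff)
    then show ?thesis using True unfolding step by (auto simp: doubleton_eq_iff)
  next
    case neq: False
    then have "\<not> crossing N (\<Lambda> i) (\<Lambda> j) k" using crossing_levels[OF assms(2)] by blast
    then show ?thesis
      using swap_less[OF assms(1) neq] unfolding step by simp
  qed
qed

text \<open>Lines start in their natural order and reverse it only at their crossing. Entry
  \<open>c\<close> of a line is its level just before commutator \<open>c\<close>, so there the old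
  order still holds.\<close>

lemma order_iff:
  assumes "i \<noteq> j" "crossing N (\<Lambda> i) (\<Lambda> j) c" "k \<le> m"
  shows "\<Lambda> i ! k < \<Lambda> j ! k \<longleftrightarrow> (if k \<le> c then i < j else j < i)"
  using assms(3)
proof (induction k)
  case 0
  then show ?case by (simp add: line_start)
next
  case (Suc k)
  have "crossing N (\<Lambda> i) (\<Lambda> j) k \<longleftrightarrow> k = c" using ex1_crossing[OF assms(1)] assms(2) by blast
  moreover have "\<Lambda> j ! k < \<Lambda> i ! k \<longleftrightarrow> \<not> \<Lambda> i ! k < \<Lambda> j ! k"
    using lines_distinct[OF assms(1), of k] Suc.prems by auto
  ultimately show ?case
    using order_step[of k i j] Suc assms(1) by auto
qed

definition upper_line :: "nat \<Rightarrow> 'n" where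
  "upper_line k = (THE i. \<Lambda> i ! k = hi k)"

definition lower_line :: "nat \<Rightarrow> 'n" where
  "lower_line k = (THE i. \<Lambda> i ! k = lo k)"

lemma upper_line_eq_iff: "k < m \<Longrightarrow> upper_line k = i \<longleftrightarrow> \<Lambda> i ! k = hi k"
  unfolding upper_line_def using the_line_at[of k _ "hi k"] ex_line_at[of k "hi k"] by (metis less_imp_le)

lemma lower_line_eq_iff: "k < m \<Longrightarrow> lower_line k = i \<longleftrightarrow> \<Lambda> i ! k = lo k"
  unfolding lower_line_def using the_line_at[of k _ "lo k"] ex_line_at[of k "lo k"] by (metis less_imp_le)

lemma upper_line_level: "k < m \<Longrightarrow> \<Lambda> (upper_line k) ! k = hi k"
  using upper_line_eq_iff by blast

lemma lower_line_level: "k < m \<Longrightarrow> \<Lambda> (lower_line k) ! k = lo k"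
  using lower_line_eq_iff by blast

lemma upper_neq_lower_line: "k < m \<Longrightarrow> upper_line k \<noteq> lower_line k"
  using upper_line_level lower_line_level lo_less_hi by force

text \<open>Any two lines cross exactly once, so crossings correspond to unordered pairs of
  lines.\<close>

lemma card_crossings: "card ({..<m} - contacts N \<Lambda>) = CARD('n) choose 2"
proof -
  have "bij_betw (\<lambda>k. {upper_line k, lower_line k}) ({..<m} - contacts N \<Lambda>) {B :: 'n set. B \<subseteq> UNIV \<and> card B = 2}"
    (is "bij_betw ?f ?K _")
  proof (rule bij_betw_imageI)
    have cross: "crossing N (\<Lambda> (upper_line k)) (\<Lambda> (lower_line k)) k" if "k \<in> ?K" for k
      using that by (auto simp: crossing_iff upper_line_level lower_line_level)
    show "inj_on ?f ?K"
    proof (rule inj_onI)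
      fix k t assume kt: "k \<in> ?K" "t \<in> ?K" "?f k = ?f t"
      have "crossing N (\<Lambda> (upper_line k)) (\<Lambda> (lower_line k)) t"
        using cross[OF kt(2)] kt(3) by (auto simp: doubleton_eq_iff crossing_def)
      then show "k = t" using cross[OF kt(1)] ex1_crossing upper_neq_lower_line kt(1) by blast
    qed
    show "?f ` ?K = {B. B \<subseteq> UNIV \<and> card B = 2}"
    proof
      show "?f ` ?K \<subseteq> {B. B \<subseteq> UNIV \<and> card B = 2}" using upper_neq_lower_line by auto
      show "{B. B \<subseteq> UNIV \<and> card B = 2} \<subseteq> ?f ` ?K"
      proof
        fix B :: "'n set" assume "B \<in> {B. B \<subseteq> UNIV \<and> card B = 2}"
        then obtain i j where B: "B = {i, j}" "i \<noteq> j" by (auto simp: card_2_iff)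
        obtain k where k: "crossing N (\<Lambda> i) (\<Lambda> j) k" using ex1_crossing[OF B(2)] by blast
        then have "k \<in> ?K" "k < m" by (auto simp: crossing_iff)
        moreover have "B = ?f k"
          using crossing_levels[OF B(2) k] upper_line_eq_iff[OF \<open>k < m\<close>] lower_line_eq_iff[OF \<open>k < m\<close>]
          unfolding B by (metis doubleton_eq_iff)
        ultimately show "B \<in> ?f ` ?K" by blast
      qed
    qed
  qed
  then have "card ({..<m} - contacts N \<Lambda>) = card {B :: 'n set. B \<subseteq> UNIV \<and> card B = 2}"
    by (rule bij_betw_same_card)
  then show ?thesis by (simp add: n_subsets[of "UNIV :: 'n set" 2, simplified])
qed

lemma contacts_subset: "contacts N \<Lambda> \<subseteq> {..<m}"
  using contacts_less by blast

lemma finite_contacts: "finite (contacts N \<Lambda>)"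
  using contacts_subset finite_lessThan by (rule finite_subset)

lemma card_contacts: "card (contacts N \<Lambda>) = m - (CARD('n) choose 2)"
  using card_crossings card_Diff_subset[OF finite_contacts contacts_subset]
    card_mono[OF finite_lessThan contacts_subset] by simp

section \<open>Bricks below a line\<close>

text \<open>The levels of commutator \<open>k\<close> are consecutive, so a threshold other than
  \<open>hi k\<close> does not separate them.\<close>

lemma above_level_step:
  assumes "k < m" "t < m" "hi k \<noteq> hi t" shows "hi t \<le> \<Lambda> i ! (k + 1) \<longleftrightarrow> hi t \<le> \<Lambda> i ! k"
proof -
  have "hi t \<le> hi k \<longleftrightarrow> hi t \<le> lo k"
  proof
    assume "hi t \<le> hi k"
    then have "hi t < hi k" using assms(3) by simp
    then show "hi t \<le> lo k" using no_level_between[OF assms(1)] not_le by blast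
  qed (use lo_less_hi[OF assms(1)] in simp)
  then show ?thesis
    using line_step[OF assms(1), of i] by (auto simp: doubleton_eq_iff)
qed

lemma above_level_const:
  assumes "s \<le> r" "r \<le> m" "t < m" "\<And>k. s \<le> k \<Longrightarrow> k < r \<Longrightarrow> hi k \<noteq> hi t"
  shows "hi t \<le> \<Lambda> i ! r \<longleftrightarrow> hi t \<le> \<Lambda> i ! s"
  using assms(1,2,4)
proof (induction r rule: dec_induct)
  case (step r)
  then show ?case using above_level_step[of r t i] assms(3) by simp
qed simp

text \<open>
  No commutator inside a brick meets its upper boundary level, so it suffices to test a line at the
  right end of the brick.
\<close>

lemma brick_below_iff:
  assumes "B \<in> bricks N"
  shows "brick_below N (\<Lambda> i) B \<longleftrightarrow> hi (snd B) \<le> \<Lambda> i ! snd B"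
proof -
  obtain s t where B: "B = (s, t)" by fastforce
  have st: "s < t" "t < m" "N ! s = N ! t" "\<And>r. s < r \<Longrightarrow> r < t \<Longrightarrow> N ! r \<noteq> N ! s"
    using assms by (auto simp: bricks_def B)
  have "hi t \<le> \<Lambda> i ! r \<longleftrightarrow> hi t \<le> \<Lambda> i ! t" if "r \<in> {s<..t}" for r
  proof -
    have "hi k \<noteq> hi t" if "r \<le> k" "k < t" for k
      using lo_eq_if_hi_eq[of k t] st \<open>r \<in> {s<..t}\<close> that by auto
    then show ?thesis using above_level_const[of r t t i] that st(2) by auto
  qed
  moreover have "t \<in> {s<..t}" using st(1) by simp
  ultimately show ?thesis unfolding B brick_below_def prod.case snd_conv st(3) by blast
qed

definition bricks_below :: "'n \<Rightarrow> (nat \<times> nat) set" where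
  "bricks_below i = {B \<in> bricks N. hi (snd B) \<le> \<Lambda> i ! snd B}"

lemma brick_vector_eq: "brick_vector N \<Lambda> $ i = real (card (bricks_below i))"
  unfolding brick_vector_def bricks_below_def by (simp add: brick_below_iff cong: conj_cong)

end

lemma finite_bricks: "finite (bricks N)"
  by (rule finite_subset[of _ "{..<m} \<times> {..<m}"]) (auto simp: bricks_def)

text \<open>Levels after a commutator follow from those before it and from whether it is a contact.
  The condition may therefore assume equal levels at \<open>k\<close>, as in a sweep.\<close>

lemma arr_eqI:
  assumes "\<Lambda> \<in> arr N" "\<Lambda>' \<in> arr N"
    and "\<And>k. k < m \<Longrightarrow> \<forall>i. \<Lambda> i ! k = \<Lambda>' i ! k \<Longrightarrow> k \<in> contacts N \<Lambda> \<longleftrightarrow> k \<in> contacts N \<Lambda>'"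
  shows "\<Lambda> = \<Lambda>'"
proof
  have *: "k \<le> m \<Longrightarrow> \<forall>i. \<Lambda> i ! k = \<Lambda>' i ! k" for k
  proof (induction k)
    case 0
    then show ?case by (simp add: line_start[OF assms(1)] line_start[OF assms(2)])
  next
    case (Suc k)
    then have IH: "\<forall>i. \<Lambda> i ! k = \<Lambda>' i ! k" and "k < m" by auto
    then have "\<Lambda> i ! (k + 1) = \<Lambda>' i ! (k + 1)" for i
      using assms(3)[of k] contact_step[OF assms(1), of k i] contact_step[OF assms(2), of k i]
        cross_step[OF assms(1), of k i] cross_step[OF assms(2), of k i]
      by (cases "k \<in> contacts N \<Lambda>") auto
    then show ?case by simp
  qed
  fix i
  show "\<Lambda> i = \<Lambda>' i"
    by (rule nth_equalityI) (use * in \<open>auto simp: length_line[OF assms(1)] length_line[OF assms(2)]\<close>)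
qed

lemma inj_contacts: "inj_on (contacts N) (arr N)"
  by (rule inj_onI, rule arr_eqI) auto

lemma finite_arr: "finite (arr N)"
proof (rule inj_on_finite[OF inj_contacts])
  show "contacts N ` arr N \<subseteq> Pow {..<m}" using contacts_subset by blast
qed simp

text \<open>
  Sweeping from left to right: at a commutator outside \<open>S\<close>, the two lines must cross if they have not
  crossed before, as their contact would not be sorted, and cannot cross again otherwise.
\<close>

lemma sorted_arr_unique:
  assumes "\<Lambda> \<in> arr N" "\<Lambda>' \<in> arr N" "S \<subseteq> contacts N \<Lambda>" "S \<subseteq> contacts N \<Lambda>'"
    and "\<And>v. v \<in> contacts N \<Lambda> - S \<Longrightarrow> upper_line \<Lambda> v < lower_line \<Lambda> v"
    and "\<And>v. v \<in> contacts N \<Lambda>' - S \<Longrightarrow> upper_line \<Lambda>' v < lower_line \<Lambda>' v"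
  shows "\<Lambda> = \<Lambda>'"
proof (rule arr_eqI[OF assms(1,2)])
  fix k assume k: "k < m" "\<forall>i. \<Lambda> i ! k = \<Lambda>' i ! k"
  have *: "k \<in> contacts N \<Lambda> \<longleftrightarrow> lower_line \<Lambda> k > upper_line \<Lambda> k"
    if \<Lambda>: "\<Lambda> \<in> arr N" and "k \<notin> S" and srt: "\<And>v. v \<in> contacts N \<Lambda> - S \<Longrightarrow> upper_line \<Lambda> v < lower_line \<Lambda> v" for \<Lambda>
  proof
    assume "k \<in> contacts N \<Lambda>"
    then show "lower_line \<Lambda> k > upper_line \<Lambda> k" using srt \<open>k \<notin> S\<close> by blast
  next
    assume less: "lower_line \<Lambda> k > upper_line \<Lambda> k"
    show "k \<in> contacts N \<Lambda>"
    proof (rule ccontr)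
      assume "k \<notin> contacts N \<Lambda>"
      then have "crossing N (\<Lambda> (upper_line \<Lambda> k)) (\<Lambda> (lower_line \<Lambda> k)) k"
        using k(1) by (simp add: crossing_iff[OF \<Lambda>] upper_line_level[OF \<Lambda>] lower_line_level[OF \<Lambda>])
      then have "\<Lambda> (upper_line \<Lambda> k) ! k < \<Lambda> (lower_line \<Lambda> k) ! k"
        using order_iff[OF \<Lambda> upper_neq_lower_line[OF \<Lambda> k(1)]] k(1) less by simp
      then show False using lo_less_hi[OF k(1)] k(1) by (simp add: upper_line_level[OF \<Lambda>] lower_line_level[OF \<Lambda>])
    qed
  qed
  have "upper_line \<Lambda> k = upper_line \<Lambda>' k" "lower_line \<Lambda> k = lower_line \<Lambda>' k"
    unfolding upper_line_def[OF assms(1)] upper_line_def[OF assms(2)]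
      lower_line_def[OF assms(1)] lower_line_def[OF assms(2)] using k(2) by simp_all
  then show "k \<in> contacts N \<Lambda> \<longleftrightarrow> k \<in> contacts N \<Lambda>'"
    using *[OF assms(1) _ assms(5)] *[OF assms(2) _ assms(6)] assms(3,4) by (cases "k \<in> S") auto
qed

section \<open>Flips and brick vectors\<close>

context
  fixes \<Lambda> i j v w
  assumes \<Lambda>: "\<Lambda> \<in> arr N" and v: "v \<in> contacts N \<Lambda>"
    and i_v: "\<Lambda> i ! v = hi v" and j_v: "\<Lambda> j ! v = lo v"
    and w: "crossing N (\<Lambda> i) (\<Lambda> j) w"
begin

text \<open>
  Flipping exchanges the lines \<open>i\<close> and \<open>j\<close> at the abscissae in \<open>strip\<close>, that is, strictly between
  the commutators \<open>v\<close> and \<open>w\<close>.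
\<close>

definition strip :: "nat set" where
  "strip = {min v w<..max v w}"

text \<open>Entry \<open>k\<close> of a line belongs to the gap just before commutator
  \<open>k\<close>, so the gaps between the two commutators have the indices from
  \<open>min v w + 1\<close> to \<open>max v w\<close>: the half-open interval in
  \<open>strip\<close>.\<close>

definition exch :: "nat \<Rightarrow> 'n \<Rightarrow> 'n" where
  "exch k = (if k \<in> strip then Transposition.transpose i j else id)"

definition flipped :: "'n \<Rightarrow> 'n list" where
  "flipped x = map (\<lambda>k. \<Lambda> (exch k x) ! k) [0..<m + 1]"

lemma v_less: "v < m" and w_less: "w < m" and w_cross: "w \<notin> contacts N \<Lambda>" and v_neq_w: "v \<noteq> w"
  using v w by (auto simp: crossing_iff[OF \<Lambda>] contacts_less[OF \<Lambda>])

lemma i_neq_j: "i \<noteq> j"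
  using i_v j_v lo_less_hi[OF v_less] by auto

lemma levels_w: "{\<Lambda> i ! w, \<Lambda> j ! w} = {lo w, hi w}"
  using crossing_levels[OF \<Lambda> i_neq_j w] .

lemma exch_exch [simp]: "exch k (exch k x) = x"
  by (simp add: exch_def)

lemma exch_Suc: "k \<noteq> v \<Longrightarrow> k \<noteq> w \<Longrightarrow> exch (k + 1) = exch k"
  and exch_Suc_ends: "k = v \<or> k = w \<Longrightarrow> exch (k + 1) x = Transposition.transpose i j (exch k x)"
  using v_neq_w by (auto simp: exch_def strip_def min_def max_def)

text \<open>At \<open>v\<close> and at \<open>w\<close> the lines \<open>i\<close> and
  \<open>j\<close> occupy the two ends of the commutator, so renaming the lines amounts to swapping
  the levels.\<close>

lemma transposed_level:
  assumes "k = v \<or> k = w"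
  shows "\<Lambda> (Transposition.transpose i j x) ! k = swap k (\<Lambda> x ! k)"
proof -
  have km: "k < m" using assms v_less w_less by auto
  have ij: "{\<Lambda> i ! k, \<Lambda> j ! k} = {lo k, hi k}" using assms i_v j_v levels_w by auto
  show ?thesis
  proof (cases "x = i \<or> x = j")
    case True
    then show ?thesis using ij by (auto simp: doubleton_eq_iff)
  next
    case False
    then have "\<Lambda> x ! k \<noteq> \<Lambda> i ! k" "\<Lambda> x ! k \<noteq> \<Lambda> j ! k"
      using level_eq_iff[OF \<Lambda>] km by auto
    then have "\<Lambda> x ! k \<notin> {lo k, hi k}" using ij by blast
    then show ?thesis using False by (simp add: transpose_apply_other)
  qed
qed

lemma flipped_nth: "k \<le> m \<Longrightarrow> flipped x ! k = \<Lambda> (exch k x) ! k"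
  unfolding flipped_def by (simp del: upt_Suc)

lemma flipped_step:
  assumes "k < m" "k \<noteq> v" "k \<noteq> w"
  shows "flipped x ! k = \<Lambda> (exch k x) ! k" "flipped x ! (k + 1) = \<Lambda> (exch k x) ! (k + 1)"
  using assms flipped_nth[of k x] flipped_nth[of "k + 1" x] exch_Suc[of k] by simp_all

text \<open>No line moves at the contact \<open>v\<close>, so the start or end of the exchange
  becomes a step across it. At \<open>w\<close>, in \<open>flipped_step_w\<close>, the exchange and
  the old crossing cancel.\<close>

lemma flipped_step_v: "flipped x ! (v + 1) = swap v (flipped x ! v)"
proof -
  have "flipped x ! (v + 1) = \<Lambda> (exch (v + 1) x) ! (v + 1)" using v_less by (intro flipped_nth) simp
  also have "\<dots> = \<Lambda> (Transposition.transpose i j (exch v x)) ! v"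
    unfolding contact_step[OF \<Lambda> v] exch_Suc_ends[OF disjI1[OF refl]] ..
  also have "\<dots> = swap v (flipped x ! v)"
    using v_less by (simp add: transposed_level flipped_nth)
  finally show ?thesis .
qed

lemma flipped_step_w: "flipped x ! (w + 1) = flipped x ! w"
proof -
  have "flipped x ! (w + 1) = \<Lambda> (exch (w + 1) x) ! (w + 1)" using w_less by (intro flipped_nth) simp
  also have "\<dots> = swap w (\<Lambda> (Transposition.transpose i j (exch w x)) ! w)"
    unfolding cross_step[OF \<Lambda> w_less w_cross] exch_Suc_ends[OF disjI2[OF refl]] ..
  also have "\<dots> = flipped x ! w"
    using w_less by (simp add: transposed_level flipped_nth)
  finally show ?thesis .
qed

lemma traverses_flipped:
  assumes "k < m"
  shows "traverses (flipped x) k \<longleftrightarrow>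
    (if k = v then x \<in> {i, j} else if k = w then False else traverses (\<Lambda> (exch k x)) k)"
proof -
  have "traverses (flipped x) v \<longleftrightarrow> x \<in> {i, j}"
  proof -
    have "traverses (flipped x) v \<longleftrightarrow> \<Lambda> (exch v x) ! v \<in> {lo v, hi v}"
      unfolding traverses_def flipped_step_v using flipped_nth[of v x] v_less lo_less_hi[OF v_less]
      by (auto simp: Transposition.transpose_def)
    also have "\<dots> \<longleftrightarrow> exch v x \<in> {i, j}"
      using i_v j_v level_eq_iff[OF \<Lambda>, of v "exch v x" i] level_eq_iff[OF \<Lambda>, of v "exch v x" j] v_less by auto
    also have "\<dots> \<longleftrightarrow> x \<in> {i, j}" by (auto simp: exch_def Transposition.transpose_def)
    finally show ?thesis .
  qed
  moreover have "\<not> traverses (flipped x) w" unfolding traverses_def flipped_step_w by simp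
  moreover have "traverses (flipped x) k \<longleftrightarrow> traverses (\<Lambda> (exch k x)) k" if "k \<noteq> v" "k \<noteq> w"
    unfolding traverses_def flipped_step[OF assms that] ..
  ultimately show ?thesis by auto
qed

lemma crossing_flipped:
  "crossing N (flipped x) (flipped y) k \<longleftrightarrow>
    (if k = v then {x, y} \<subseteq> {i, j} else k \<noteq> w \<and> crossing N (\<Lambda> (exch k x)) (\<Lambda> (exch k y)) k)"
  using traverses_flipped[of k x] traverses_flipped[of k y] v_less
  by (cases "k = v"; cases "k = w") (auto simp: crossing_def)

lemma exch_pair: "{x, y} = {i, j} \<longleftrightarrow> {exch k x, exch k y} = {i, j}"
  by (auto simp: exch_def Transposition.transpose_def doubleton_eq_iff)

text \<open>Two lines cross in the strip exactly if their order differs at \<open>v\<close> and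
  \<open>w\<close>. This form is useful because orders at \<open>v\<close> and \<open>w\<close> are
  unaffected by transposing \<open>i\<close> and \<open>j\<close>.\<close>

lemma crossing_in_strip_iff:
  assumes "x \<noteq> y" "{x, y} \<noteq> {i, j}" "crossing N (\<Lambda> x) (\<Lambda> y) c"
  shows "c \<noteq> v" and "c \<noteq> w" and "c \<in> strip \<longleftrightarrow> (\<Lambda> x ! v < \<Lambda> y ! v \<longleftrightarrow> \<Lambda> y ! w < \<Lambda> x ! w)"
proof -
  show "c \<noteq> v" using assms(3) v by (auto simp: crossing_iff[OF \<Lambda>])
  show "c \<noteq> w"
  proof
    assume "c = w"
    then have "{\<Lambda> x ! w, \<Lambda> y ! w} = {\<Lambda> i ! w, \<Lambda> j ! w}"
      using crossing_levels[OF \<Lambda> assms(1,3)] levels_w by simp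
    then show False using assms(2) level_eq_iff[OF \<Lambda>, of w] w_less by (auto simp: doubleton_eq_iff)
  qed
  have "\<Lambda> y ! w < \<Lambda> x ! w \<longleftrightarrow> \<not> \<Lambda> x ! w < \<Lambda> y ! w"
    using lines_distinct[OF \<Lambda> assms(1), of w] w_less by auto
  then show "c \<in> strip \<longleftrightarrow> (\<Lambda> x ! v < \<Lambda> y ! v \<longleftrightarrow> \<Lambda> y ! w < \<Lambda> x ! w)"
    using order_iff[OF \<Lambda> assms(1,3), of v] order_iff[OF \<Lambda> assms(1,3), of w] v_less w_less
      \<open>c \<noteq> v\<close> \<open>c \<noteq> w\<close> assms(1)
    by (auto simp: strip_def min_def max_def)
qed

lemma transposed_less:
  assumes "k = v \<or> k = w" "{x, y} \<noteq> {i, j}"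
  shows "\<Lambda> (Transposition.transpose i j x) ! k < \<Lambda> (Transposition.transpose i j y) ! k \<longleftrightarrow> \<Lambda> x ! k < \<Lambda> y ! k"
proof -
  have km: "k < m" using assms v_less w_less by auto
  have "{\<Lambda> i ! k, \<Lambda> j ! k} = {lo k, hi k}" using assms(1) i_v j_v levels_w by auto
  then have "{\<Lambda> x ! k, \<Lambda> y ! k} \<noteq> {lo k, hi k}"
    using assms(2) inj_image_eq_iff[OF inj_level[OF \<Lambda>, of k], of "{x, y}" "{i, j}"] km by auto
  then show ?thesis unfolding transposed_level[OF assms(1)]
    by (rule swap_less[OF km])
qed

text \<open>
  At \<open>v\<close> and at \<open>w\<close> the lines \<open>i\<close> and \<open>j\<close> are adjacent, so a third line crosses either both
  or neither of them inside the strip.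
\<close>

lemma ex1_crossing_flipped:
  assumes "x \<noteq> y" shows "\<exists>!k. crossing N (flipped x) (flipped y) k"
proof (cases "{x, y} = {i, j}")
  case True
  have "\<not> crossing N (\<Lambda> (exch k x)) (\<Lambda> (exch k y)) k" if "k \<noteq> w" for k
  proof
    assume "crossing N (\<Lambda> (exch k x)) (\<Lambda> (exch k y)) k"
    moreover have "{exch k x, exch k y} = {i, j}" using True exch_pair[of x y k] by simp
    then have "exch k x = i \<and> exch k y = j \<or> exch k x = j \<and> exch k y = i"
      by (simp only: doubleton_eq_iff)
    ultimately have "crossing N (\<Lambda> i) (\<Lambda> j) k" using crossing_commute by metis
    then show False using w that ex1_crossing[OF \<Lambda> i_neq_j] by blast
  qed
  then have "crossing N (flipped x) (flipped y) k \<longleftrightarrow> k = v" for k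
    unfolding crossing_flipped using True by auto
  then show ?thesis by simp
next
  case False
  let ?t = "Transposition.transpose i j"
  obtain c where c: "crossing N (\<Lambda> x) (\<Lambda> y) c" using ex1_crossing[OF \<Lambda> assms] by blast
  have t_neq: "?t x \<noteq> ?t y" using assms by (auto simp: transpose_eq_iff)
  obtain d where d: "crossing N (\<Lambda> (?t x)) (\<Lambda> (?t y)) d" using ex1_crossing[OF \<Lambda> t_neq] by blast
  have False': "{?t x, ?t y} \<noteq> {i, j}" using False by (auto simp: Transposition.transpose_def doubleton_eq_iff split: if_splits)
  note c' = crossing_in_strip_iff[OF assms False c]
  note d' = crossing_in_strip_iff[OF t_neq False' d]
  have False'': "{y, x} \<noteq> {i, j}" using False by (simp add: insert_commute)
  \<comment> \<open>The original and the transposed pair have the same orders at \<open>v\<close>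
    and \<open>w\<close>, so \<open>c\<close> and \<open>d\<close> lie on the same side of the strip
    boundary. The flipped pair keeps \<open>d\<close> if both are inside and \<open>c\<close> if
    both are outside.\<close>
  have cd: "c \<in> strip \<longleftrightarrow> d \<in> strip"
    using c'(3) d'(3) transposed_less[OF disjI1[OF refl] False] transposed_less[OF disjI2[OF refl] False''] by simp
  have *: "crossing N (flipped x) (flipped y) k \<longleftrightarrow> (if k \<in> strip then k = d else k = c)" for k
  proof -
    have "crossing N (\<Lambda> x) (\<Lambda> y) k \<longleftrightarrow> k = c" using c ex1_crossing[OF \<Lambda> assms] by blast
    moreover have "crossing N (\<Lambda> (?t x)) (\<Lambda> (?t y)) k \<longleftrightarrow> k = d" using d ex1_crossing[OF \<Lambda> t_neq] by blast
    moreover have "\<not> {x, y} \<subseteq> {i, j}" using False assms by auto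
    ultimately show ?thesis using c'(1,2) d'(1,2) unfolding crossing_flipped exch_def by auto
  qed
  show ?thesis
  proof (cases "c \<in> strip")
    case True
    then show ?thesis using cd * by (intro ex1I[of _ d]) (auto split: if_splits)
  next
    case False
    then show ?thesis using cd * by (intro ex1I[of _ c]) (auto split: if_splits)
  qed
qed

lemma flipped_arr: "flipped \<in> arr N"
proof -
  have "pseudoline N (flipped x)" for x
  proof -
    have "flipped x ! (k + 1) = flipped x ! k \<or> {flipped x ! k, flipped x ! (k + 1)} = {lo k, hi k}"
      if "k < m" for k
    proof (cases "k = v \<or> k = w")
      case True
      have "swap v l = l \<or> {l, swap v l} = {lo v, hi v}" for l
        by (auto simp: Transposition.transpose_def)
      then show ?thesis using True flipped_step_v[of x] flipped_step_w[of x] by metis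
    next
      case False
      then show ?thesis using flipped_step[OF that, of x] line_step[OF \<Lambda> that] by metis
    qed
    then show ?thesis by (simp add: pseudoline_def flipped_def del: upt_Suc)
  qed
  moreover have "flipped x ! 0 = x" for x
    by (simp add: flipped_nth exch_def strip_def line_start[OF \<Lambda>])
  moreover have "flipped x ! k \<noteq> flipped y ! k" if "x \<noteq> y" "k \<le> m" for x y k
  proof -
    have "exch k x \<noteq> exch k y" using that(1) exch_exch by metis
    then show ?thesis using lines_distinct[OF \<Lambda> _ that(2)] by (simp add: flipped_nth[OF that(2)])
  qed
  ultimately show ?thesis using ex1_crossing_flipped by (simp add: arr_def)
qed

lemma contacts_flipped: "contacts N flipped = insert w (contacts N \<Lambda> - {v})"
proof (rule set_eqI)
  fix k
  have "(\<forall>x. \<not> traverses (\<Lambda> (exch k x)) k) \<longleftrightarrow> (\<forall>x. \<not> traverses (\<Lambda> x) k)"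
    using exch_exch by metis
  then show "k \<in> contacts N flipped \<longleftrightarrow> k \<in> insert w (contacts N \<Lambda> - {v})"
    using v_less w_less v_neq_w traverses_flipped[of k]
    by (cases "k = v"; cases "k = w") (auto simp: contacts_iff[OF flipped_arr] contacts_iff[OF \<Lambda>])
qed

text \<open>Line \<open>i\<close> is above \<open>j\<close> at \<open>v\<close>, and their order
  changes only at \<open>w\<close>, which bounds the strip.\<close>

lemma i_above_j_strip:
  assumes "k \<in> strip" shows "\<Lambda> j ! k < \<Lambda> i ! k"
proof -
  have "k \<le> m" using assms v_less w_less by (auto simp: strip_def)
  have "crossing N (\<Lambda> j) (\<Lambda> i) w" using w by (auto simp: crossing_def)
  note order = order_iff[OF \<Lambda> i_neq_j[symmetric] this]
  have "\<Lambda> j ! v < \<Lambda> i ! v" using i_v j_v lo_less_hi[OF v_less] by simp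
  then show ?thesis
    using order[of v] order[OF \<open>k \<le> m\<close>] v_less assms
    by (auto simp: strip_def min_def max_def split: if_splits)
qed

lemma upper_flipped: "k < m \<Longrightarrow> upper_line flipped k = exch k (upper_line \<Lambda> k)"
  and lower_flipped: "k < m \<Longrightarrow> lower_line flipped k = exch k (lower_line \<Lambda> k)"
  by (simp_all add: upper_line_eq_iff[OF flipped_arr] lower_line_eq_iff[OF flipped_arr] flipped_nth
      upper_line_level[OF \<Lambda>] lower_line_level[OF \<Lambda>])

text \<open>The new contact has the reversed arc. For \<open>w\<close> right of \<open>v\<close> the
  levels are read at \<open>w\<close>, which is in the strip; otherwise the strip starts at
  \<open>w + 1\<close>, just after the crossing.\<close>

lemma upper_flipped_w: "upper_line flipped w = j" and lower_flipped_w: "lower_line flipped w = i"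
proof -
  have "flipped j ! w = hi w \<and> flipped i ! w = lo w"
  proof (cases "w \<in> strip")
    case True
    then have "\<Lambda> i ! w = hi w" "\<Lambda> j ! w = lo w"
      using i_above_j_strip[OF True] levels_w lo_less_hi[OF w_less] by (auto simp: doubleton_eq_iff)
    then show ?thesis using True w_less by (simp add: flipped_nth exch_def)
  next
    case False
    then have "w + 1 \<in> strip" using v_neq_w by (auto simp: strip_def min_def max_def split: if_splits)
    then have "\<Lambda> j ! (w + 1) < \<Lambda> i ! (w + 1)" by (rule i_above_j_strip)
    then have "\<Lambda> i ! w < \<Lambda> j ! w" using order_step[OF \<Lambda> w_less i_neq_j[symmetric]] w
      by (auto simp: crossing_def)
    then have "\<Lambda> j ! w = hi w" "\<Lambda> i ! w = lo w"
      using levels_w lo_less_hi[OF w_less] by (auto simp: doubleton_eq_iff)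
    then show ?thesis using False w_less by (simp add: flipped_nth exch_def)
  qed
  then show "upper_line flipped w = j" "lower_line flipped w = i"
    by (simp_all add: upper_line_eq_iff[OF flipped_arr w_less] lower_line_eq_iff[OF flipped_arr w_less])
qed

section \<open>Change of the brick vector under a flip\<close>

text \<open>The bricks with right end in the strip that lie below \<open>i\<close> but not below
  \<open>j\<close>. The exchange hands them from \<open>i\<close> to \<open>j\<close>.\<close>

definition lost_bricks :: "(nat \<times> nat) set" where
  "lost_bricks = {B \<in> bricks N. snd B \<in> strip \<and> \<Lambda> j ! snd B < hi (snd B) \<and> hi (snd B) \<le> \<Lambda> i ! snd B}"

lemma brick_less: "B \<in> bricks N \<Longrightarrow> snd B < m"
  by (auto simp: bricks_def)

lemma mem_bricks_below:
  "B \<in> bricks_below \<Lambda> x \<longleftrightarrow> B \<in> bricks N \<and> hi (snd B) \<le> \<Lambda> x ! snd B"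
  "B \<in> bricks_below flipped x \<longleftrightarrow> B \<in> bricks N \<and> hi (snd B) \<le> \<Lambda> (exch (snd B) x) ! snd B"
  "B \<in> lost_bricks \<longleftrightarrow> B \<in> bricks N \<and> snd B \<in> strip \<and> \<Lambda> j ! snd B < hi (snd B) \<and> hi (snd B) \<le> \<Lambda> i ! snd B"
  using flipped_nth[of "snd B" x] brick_less[of B]
  unfolding bricks_below_def[OF \<Lambda>] bricks_below_def[OF flipped_arr] lost_bricks_def by auto

lemma bricks_below_i: "bricks_below \<Lambda> i = bricks_below flipped i \<union> lost_bricks"
  and disjoint_i: "bricks_below flipped i \<inter> lost_bricks = {}"
  and bricks_below_j: "bricks_below flipped j = bricks_below \<Lambda> j \<union> lost_bricks"
  and disjoint_j: "bricks_below \<Lambda> j \<inter> lost_bricks = {}"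
proof -
  have "(B \<in> bricks_below \<Lambda> i \<longleftrightarrow> B \<in> bricks_below flipped i \<or> B \<in> lost_bricks) \<and>
      (B \<in> bricks_below flipped i \<longrightarrow> B \<notin> lost_bricks) \<and>
      (B \<in> bricks_below flipped j \<longleftrightarrow> B \<in> bricks_below \<Lambda> j \<or> B \<in> lost_bricks) \<and>
      (B \<in> bricks_below \<Lambda> j \<longrightarrow> B \<notin> lost_bricks)" for B
    using i_above_j_strip[of "snd B"]
    by (cases "snd B \<in> strip") (auto simp: mem_bricks_below exch_def)
  then show "bricks_below \<Lambda> i = bricks_below flipped i \<union> lost_bricks"
    "bricks_below flipped i \<inter> lost_bricks = {}"
    "bricks_below flipped j = bricks_below \<Lambda> j \<union> lost_bricks"
    "bricks_below \<Lambda> j \<inter> lost_bricks = {}" by blast+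
qed

lemma bricks_below_other: "x \<noteq> i \<Longrightarrow> x \<noteq> j \<Longrightarrow> bricks_below flipped x = bricks_below \<Lambda> x"
  by (rule set_eqI) (simp add: mem_bricks_below exch_def transpose_apply_other)

text \<open>Consecutive levels leave room for only one separating threshold.\<close>

lemma hi_eq_if_straddled:
  assumes "k < m" "{\<Lambda> i ! r, \<Lambda> j ! r} = {lo k, hi k}" "hi v \<le> \<Lambda> i ! r" "\<not> hi v \<le> \<Lambda> j ! r"
  shows "hi k = hi v"
proof -
  have "lo k < hi v" "hi v \<le> hi k"
    using assms lo_less_hi[OF assms(1)] by (auto simp: doubleton_eq_iff)
  then show ?thesis using no_level_between[OF assms(1)] by force
qed

text \<open>At \<open>v\<close> the level \<open>hi v\<close> separates the two lines, and it does
  so until a commutator at this level is met. By \<open>w\<close> one is met, since \<open>w\<close>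
  joins the two lines. The one nearest to \<open>v\<close> bounds a brick together with
  \<open>v\<close>.\<close>

lemma lost_bricks_nonempty: "lost_bricks \<noteq> {}"
proof (cases "v < w")
  case True
  have above: "hi v \<le> \<Lambda> i ! v" "\<not> hi v \<le> \<Lambda> j ! v" using i_v j_v lo_less_hi[OF v_less] by auto
  have next_ex: "\<exists>k. v < k \<and> k \<le> w \<and> hi k = hi v"
  proof (rule ccontr)
    assume none: "\<nexists>k. v < k \<and> k \<le> w \<and> hi k = hi v"
    have "hi v \<le> \<Lambda> x ! w \<longleftrightarrow> hi v \<le> \<Lambda> x ! v" for x
    proof -
      have "hi v \<le> \<Lambda> x ! w \<longleftrightarrow> hi v \<le> \<Lambda> x ! (v + 1)"
        using none True w_less v_less by (intro above_level_const[OF \<Lambda>]) auto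
      then show ?thesis using contact_step[OF \<Lambda> v, of x] by simp
    qed
    then have "hi w = hi v" using hi_eq_if_straddled[OF w_less levels_w] above by blast
    then show False using none True by blast
  qed
  define k where "k = (LEAST k. v < k \<and> k \<le> w \<and> hi k = hi v)"
  have k: "v < k" "k \<le> w" "hi k = hi v" using LeastI_ex[OF next_ex] unfolding k_def by blast+
  have least: "hi t \<noteq> hi v" if "v < t" "t < k" for t
    using not_less_Least[of t "\<lambda>k. v < k \<and> k \<le> w \<and> hi k = hi v"] that k(2) unfolding k_def by auto
  have "k < m" using k(2) w_less by simp
  have "hi v \<le> \<Lambda> x ! k \<longleftrightarrow> hi v \<le> \<Lambda> x ! v" for x
  proof -
    have "hi v \<le> \<Lambda> x ! k \<longleftrightarrow> hi v \<le> \<Lambda> x ! (v + 1)"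
      using least k \<open>k < m\<close> v_less by (intro above_level_const[OF \<Lambda>]) auto
    then show ?thesis using contact_step[OF \<Lambda> v, of x] by simp
  qed
  then have "hi v \<le> \<Lambda> i ! k" "\<not> hi v \<le> \<Lambda> j ! k" using above by blast+
  moreover have "(v, k) \<in> bricks N"
  proof -
    have "N ! t \<noteq> N ! v" if "v < t" "t < k" for t using least[OF that] by auto
    then show ?thesis
      using k \<open>k < m\<close> v_less lo_eq_if_hi_eq[of v k] by (simp add: bricks_def)
  qed
  moreover have "k \<in> strip" using k by (simp add: strip_def)
  ultimately have "(v, k) \<in> lost_bricks" unfolding lost_bricks_def by (simp add: k(3))
  then show ?thesis by blast
next
  case False
  then have "w < v" using v_neq_w by simp
  have above: "hi v \<le> \<Lambda> i ! v" "\<not> hi v \<le> \<Lambda> j ! v" using i_v j_v lo_less_hi[OF v_less] by auto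
  have prev_ex: "\<exists>k. w \<le> k \<and> k < v \<and> hi k = hi v"
  proof (rule ccontr)
    assume none: "\<nexists>k. w \<le> k \<and> k < v \<and> hi k = hi v"
    have "hi v \<le> \<Lambda> x ! v \<longleftrightarrow> hi v \<le> \<Lambda> x ! (w + 1)" for x
      using none \<open>w < v\<close> v_less by (intro above_level_const[OF \<Lambda>]) auto
    moreover have "{\<Lambda> i ! (w + 1), \<Lambda> j ! (w + 1)} = {lo w, hi w}"
      unfolding cross_step[OF \<Lambda> w_less w_cross] using levels_w by (auto simp: doubleton_eq_iff)
    ultimately have "hi w = hi v" using hi_eq_if_straddled[OF w_less] above by blast
    then show False using none \<open>w < v\<close> by blast
  qed
  then have "\<exists>k. (w \<le> k \<and> k < v \<and> hi k = hi v) \<and> (\<forall>t. w \<le> t \<and> t < v \<and> hi t = hi v \<longrightarrow> t \<le> k)"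
    using ex_has_greatest_nat[of "\<lambda>k. w \<le> k \<and> k < v \<and> hi k = hi v" _ "\<lambda>k. k" v] by auto
  then obtain k where k: "w \<le> k" "k < v" "hi k = hi v"
    and greatest: "\<And>t. w \<le> t \<Longrightarrow> t < v \<Longrightarrow> hi t = hi v \<Longrightarrow> t \<le> k" by blast
  have "(k, v) \<in> bricks N"
  proof -
    have "N ! t \<noteq> N ! k" if "k < t" "t < v" for t using greatest[of t] that k by auto
    then show ?thesis using k v_less lo_eq_if_hi_eq[of k v] by (simp add: bricks_def)
  qed
  moreover have "v \<in> strip" using \<open>w < v\<close> by (simp add: strip_def)
  ultimately have "(k, v) \<in> lost_bricks" using above by (auto simp: lost_bricks_def)
  then show ?thesis by blast
qed

lemma brick_vector_flipped:
  "brick_vector N flipped = brick_vector N \<Lambda> + real (card lost_bricks) *\<^sub>R (axis j 1 - axis i 1)"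
proof -
  have fin: "finite (bricks_below M x)" if "M \<in> arr N" for M x
    unfolding bricks_below_def[OF that] using finite_bricks by simp
  have fin_lost: "finite lost_bricks" unfolding lost_bricks_def using finite_bricks by simp
  have "real (card (bricks_below \<Lambda> i)) = real (card (bricks_below flipped i)) + card lost_bricks"
    unfolding bricks_below_i by (simp add: card_Un_disjoint fin[OF flipped_arr] fin_lost disjoint_i)
  moreover have "real (card (bricks_below flipped j)) = real (card (bricks_below \<Lambda> j)) + card lost_bricks"
    unfolding bricks_below_j by (simp add: card_Un_disjoint fin[OF \<Lambda>] fin_lost disjoint_j)
  ultimately show ?thesis
    using i_neq_j by (auto simp: vec_eq_iff brick_vector_eq[OF \<Lambda>] brick_vector_eq[OF flipped_arr] axis_def
        bricks_below_other)
qed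

lemma lost_bricks_card_pos: "0 < real (card lost_bricks)"
  using lost_bricks_nonempty finite_bricks by (simp add: card_gt_0_iff lost_bricks_def)

lemma crossing_flipped_v: "crossing N (flipped i) (flipped j) v"
  by (simp add: crossing_flipped)

end

section \<open>Networks as flip systems\<close>

text \<open>Along an undirected walk from \<open>l\<close> to \<open>k\<close> the signed arcs
  telescope to the difference of two unit vectors, and such differences span the sum-zero
  vectors.\<close>

lemma contact_arcs_span:
  assumes "\<Lambda> \<in> arr N" "Digraph_Component.connected (contact_graph N \<Lambda>)"
  shows "{x :: (real, 'n) vec. (\<Sum>i\<in>UNIV. x $ i) = 0} \<subseteq>
    span ((\<lambda>v. axis (lower_line \<Lambda> v) 1 - axis (upper_line \<Lambda> v) 1) ` contacts N \<Lambda>)" (is "_ \<subseteq> ?S")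
proof
  have step: "axis (lower_line \<Lambda> v) 1 - axis (upper_line \<Lambda> v) 1 \<in> ?S" if "v \<in> contacts N \<Lambda>" for v
    using that by (intro span_base) blast
  have diff: "axis k 1 - axis l 1 \<in> ?S" for k l
  proof -
    have "l \<rightarrow>\<^sup>*\<^bsub>with_proj (mk_symmetric (contact_graph N \<Lambda>))\<^esub> k"
      using assms(2) by (auto simp: Digraph_Component.connected_def strongly_connected_def contact_graph_def)
    then show ?thesis
    proof (rule reachable_mk_symmetric_induct[where P = "\<lambda>k. axis k 1 - axis l 1 \<in> ?S"])
      show "axis l 1 - axis l 1 \<in> ?S" by (simp add: span_zero)
      fix e assume "e \<in> arcs (contact_graph N \<Lambda>)"
      then have e: "e \<in> contacts N \<Lambda>" by (simp add: contact_graph_def)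
      have "tail (contact_graph N \<Lambda>) e = upper_line \<Lambda> e" "head (contact_graph N \<Lambda>) e = lower_line \<Lambda> e"
        by (simp_all add: contact_graph_def upper_line_def[OF assms(1)] lower_line_def[OF assms(1)])
      moreover have "axis (upper_line \<Lambda> e) 1 - axis l 1 \<in> ?S \<longleftrightarrow> axis (lower_line \<Lambda> e) 1 - axis l 1 \<in> ?S"
      proof
        assume "axis (upper_line \<Lambda> e) 1 - axis l 1 \<in> ?S"
        from span_add[OF this step[OF e]] show "axis (lower_line \<Lambda> e) 1 - axis l 1 \<in> ?S" by simp
      next
        assume "axis (lower_line \<Lambda> e) 1 - axis l 1 \<in> ?S"
        from span_diff[OF this step[OF e]] show "axis (upper_line \<Lambda> e) 1 - axis l 1 \<in> ?S" by simp
      qed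
      ultimately show "axis (tail (contact_graph N \<Lambda>) e) 1 - axis l 1 \<in> ?S \<longleftrightarrow>
        axis (head (contact_graph N \<Lambda>) e) 1 - axis l 1 \<in> ?S" by simp
    qed
  qed
  fix x :: "(real, 'n) vec" assume "x \<in> {x. (\<Sum>i\<in>UNIV. x $ i) = 0}"
  then have x: "(\<Sum>i\<in>UNIV. x $ i) = 0" by simp
  \<comment> \<open>\<open>undefined\<close> is an arbitrary base line; its total coefficient is the
    coordinate sum of \<open>x\<close>, which is 0.\<close>
  have "x = (\<Sum>i\<in>UNIV. x $ i *\<^sub>R (axis i 1 - axis (undefined :: 'n) 1))"
  proof (rule vec_eq_iff[THEN iffD2, rule_format])
    fix k
    have "(\<Sum>i\<in>UNIV. x $ i *\<^sub>R (axis i 1 - axis (undefined :: 'n) 1)) $ k =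
      (\<Sum>i\<in>UNIV. (if k = i then x $ i else 0)) - (\<Sum>i\<in>UNIV. x $ i) * (axis (undefined :: 'n) 1 $ k)"
      unfolding sum_distrib_right sum_subtractf[symmetric] sum_component
      by (rule sum.cong) (auto simp: axis_def)
    then show "x $ k = (\<Sum>i\<in>UNIV. x $ i *\<^sub>R (axis i 1 - axis (undefined :: 'n) 1)) $ k"
      by (simp add: x)
  qed
  moreover have "(\<Sum>i\<in>UNIV. x $ i *\<^sub>R (axis i 1 - axis (undefined :: 'n) 1)) \<in> ?S"
    by (intro span_sum span_scale diff)
  ultimately show "x \<in> ?S" by simp
qed

definition crossing_of :: "('n \<Rightarrow> 'n list) \<Rightarrow> 'n \<Rightarrow> 'n \<Rightarrow> nat" where
  "crossing_of \<Lambda> i j = (THE k. crossing N (\<Lambda> i) (\<Lambda> j) k)"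

lemma flip_system_arr:
  assumes min: "minimal_irreducible_sorting N"
  shows "flip_system (arr N) (contacts N) upper_line lower_line crossing_of (brick_vector N)"
proof
  show "finite (arr N)" by (rule finite_arr)
  show "arr N \<noteq> {}" using min by (simp add: minimal_irreducible_sorting_def sorting_def)
  show "inj_on (contacts N) (arr N)" by (rule inj_contacts)
next
  fix \<Lambda> assume \<Lambda>: "\<Lambda> \<in> arr N"
  show "finite (contacts N \<Lambda>)" by (rule finite_contacts[OF \<Lambda>])
  \<comment> \<open>Here the prescribed number of commutators is used: removing the crossings leaves
    n - 1 contacts.\<close>
  show "card (contacts N \<Lambda>) = CARD('n) - 1"
    using min unfolding card_contacts[OF \<Lambda>] by (simp add: minimal_irreducible_sorting_def)
  show "{x :: (real, 'n) vec. (\<Sum>i\<in>UNIV. x $ i) = 0} \<subseteq>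
    span ((\<lambda>v. axis (lower_line \<Lambda> v) 1 - axis (upper_line \<Lambda> v) 1) ` contacts N \<Lambda>)"
    using min \<Lambda> by (intro contact_arcs_span) (auto simp: minimal_irreducible_sorting_def irreducible_network_def)
next
  fix \<Lambda> v assume \<Lambda>: "\<Lambda> \<in> arr N" and v: "v \<in> contacts N \<Lambda>"
  define i j where "i = upper_line \<Lambda> v" and "j = lower_line \<Lambda> v"
  have "v < m" using contacts_less[OF \<Lambda> v] .
  then have ij: "\<Lambda> i ! v = hi v" "\<Lambda> j ! v = lo v" "i \<noteq> j"
    using upper_line_level[OF \<Lambda>] lower_line_level[OF \<Lambda>] upper_neq_lower_line[OF \<Lambda>]
    by (simp_all add: i_def j_def)
  obtain w where w: "crossing N (\<Lambda> i) (\<Lambda> j) w" using ex1_crossing[OF \<Lambda> ij(3)] by blast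
  note flip = \<Lambda> v ij(1,2) w
  let ?M = "flipped \<Lambda> i j v w"
  have M: "?M \<in> arr N" by (rule flipped_arr[OF flip])
  have "w \<notin> contacts N \<Lambda>" using w by (simp add: crossing_iff[OF \<Lambda>])
  moreover have "crossing_of ?M i j = v"
    unfolding crossing_of_def
    using crossing_flipped_v[OF flip] ex1_crossing[OF M ij(3)] by (intro the1_equality) auto
  moreover have "upper_line ?M u = upper_line \<Lambda> u \<and> lower_line ?M u = lower_line \<Lambda> u \<or>
      upper_line ?M u = Transposition.transpose i j (upper_line \<Lambda> u) \<and>
      lower_line ?M u = Transposition.transpose i j (lower_line \<Lambda> u)" if "u \<in> contacts N \<Lambda> - {v}" for u
  proof -
    have "u < m" using that contacts_less[OF \<Lambda>] by blast
    then show ?thesis unfolding upper_flipped[OF flip \<open>u < m\<close>] lower_flipped[OF flip \<open>u < m\<close>]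
      by (simp add: exch_def[OF flip])
  qed
  ultimately show "\<exists>\<Lambda>'\<in>arr N. \<exists>w l. w \<notin> contacts N \<Lambda> \<and> contacts N \<Lambda>' = insert w (contacts N \<Lambda> - {v}) \<and>
     upper_line \<Lambda>' w = lower_line \<Lambda> v \<and> lower_line \<Lambda>' w = upper_line \<Lambda> v \<and>
     crossing_of \<Lambda>' (upper_line \<Lambda> v) (lower_line \<Lambda> v) = v \<and>
     (\<forall>u\<in>contacts N \<Lambda> - {v}. upper_line \<Lambda>' u = upper_line \<Lambda> u \<and> lower_line \<Lambda>' u = lower_line \<Lambda> u \<or>
        upper_line \<Lambda>' u = Transposition.transpose (upper_line \<Lambda> v) (lower_line \<Lambda> v) (upper_line \<Lambda> u) \<and>
        lower_line \<Lambda>' u = Transposition.transpose (upper_line \<Lambda> v) (lower_line \<Lambda> v) (lower_line \<Lambda> u)) \<and>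
     0 < l \<and> brick_vector N \<Lambda>' = brick_vector N \<Lambda> + l *\<^sub>R (axis (lower_line \<Lambda> v) 1 - axis (upper_line \<Lambda> v) 1)"
    unfolding i_def[symmetric] j_def[symmetric]
    using M contacts_flipped[OF flip] upper_flipped_w[OF flip] lower_flipped_w[OF flip]
      lost_bricks_card_pos[OF flip] brick_vector_flipped[OF flip]
    by (intro bexI[of _ ?M] exI[of _ w] exI[of _ "real (card (lost_bricks \<Lambda> i j v w))"]) simp_all
next
  fix \<Lambda>1 \<Lambda>2 S assume "\<Lambda>1 \<in> arr N" "\<Lambda>2 \<in> arr N" "S \<subseteq> contacts N \<Lambda>1" "S \<subseteq> contacts N \<Lambda>2"
    "\<And>v. v \<in> contacts N \<Lambda>1 - S \<Longrightarrow> upper_line \<Lambda>1 v < lower_line \<Lambda>1 v"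
    "\<And>v. v \<in> contacts N \<Lambda>2 - S \<Longrightarrow> upper_line \<Lambda>2 v < lower_line \<Lambda>2 v"
  then show "\<Lambda>1 = \<Lambda>2" by (rule sorted_arr_unique)
qed

text \<open>Describes flips by contact sets alone, as the common ground for \<open>flip\<close> and
  \<open>flips\<close>. The constructed \<open>flipped\<close> shares all contacts but
  \<open>v\<close> with \<Lambda>, and by \<open>ridge\<close> so does only one arrangement other
  than \<Lambda>.\<close>

lemma flip_arr_iff:
  assumes min: "minimal_irreducible_sorting N" and \<Lambda>: "\<Lambda> \<in> arr N" and M: "M \<in> arr N"
  shows "flip N \<Lambda> M \<longleftrightarrow> M \<noteq> \<Lambda> \<and> (\<exists>v\<in>contacts N \<Lambda>. contacts N \<Lambda> - {v} \<subseteq> contacts N M)"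
proof
  assume "flip N \<Lambda> M"
  then obtain i j v w where c: "i \<noteq> j" "contact N (\<Lambda> i) (\<Lambda> j) v" "crossing N (\<Lambda> i) (\<Lambda> j) w"
    "contacts N M = (contacts N \<Lambda> - {v}) \<union> {w}" unfolding flip_def by blast
  have "v \<in> contacts N \<Lambda>" using c(2) contact_iff[OF \<Lambda>] by blast
  moreover have "w \<notin> contacts N \<Lambda>" using c(3) crossing_iff[OF \<Lambda>] by blast
  ultimately show "M \<noteq> \<Lambda> \<and> (\<exists>v\<in>contacts N \<Lambda>. contacts N \<Lambda> - {v} \<subseteq> contacts N M)" using c(4) by blast
next
  interpret flip_system "arr N" "contacts N" upper_line lower_line crossing_of "brick_vector N"
    using min by (rule flip_system_arr)
  assume "M \<noteq> \<Lambda> \<and> (\<exists>v\<in>contacts N \<Lambda>. contacts N \<Lambda> - {v} \<subseteq> contacts N M)"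
  then obtain v where v: "M \<noteq> \<Lambda>" "v \<in> contacts N \<Lambda>" "contacts N \<Lambda> - {v} \<subseteq> contacts N M" by blast
  define i j where "i = upper_line \<Lambda> v" and "j = lower_line \<Lambda> v"
  have "v < m" using contacts_less[OF \<Lambda> v(2)] .
  then have ij: "\<Lambda> i ! v = hi v" "\<Lambda> j ! v = lo v" "i \<noteq> j"
    using upper_line_level[OF \<Lambda>] lower_line_level[OF \<Lambda>] upper_neq_lower_line[OF \<Lambda>]
    by (simp_all add: i_def j_def)
  obtain w where w: "crossing N (\<Lambda> i) (\<Lambda> j) w" using ex1_crossing[OF \<Lambda> ij(3)] by blast
  note flip = \<Lambda> v(2) ij(1,2) w
  let ?F = "flipped \<Lambda> i j v w"
  have F: "?F \<in> arr N" "contacts N ?F = insert w (contacts N \<Lambda> - {v})"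
    by (rule flipped_arr[OF flip], rule contacts_flipped[OF flip])
  have "w \<notin> contacts N \<Lambda>" using w crossing_iff[OF \<Lambda>] by blast
  then have "?F \<noteq> \<Lambda>" using F(2) by (metis insertI1)
  obtain \<Lambda>' where \<Lambda>': "\<Lambda>' \<in> arr N" "flips \<Lambda> v \<Lambda>'" using flip_exists[OF \<Lambda> v(2)] .
  have "?F \<in> {\<Lambda>, \<Lambda>'}" "M \<in> {\<Lambda>, \<Lambda>'}"
    using ridge[OF \<Lambda> v(2) \<Lambda>'] F M v(3) by blast+
  then have "?F = M" using \<open>?F \<noteq> \<Lambda>\<close> v(1) by blast
  moreover have "contact N (\<Lambda> i) (\<Lambda> j) v" using v(2) ij(1,2) by (auto simp: contact_iff[OF \<Lambda>])
  ultimately show "flip N \<Lambda> M" using w ij(3) F(2) unfolding flip_def by blast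
qed

end

theorem theorem3p26:
  fixes N :: "'n::{finite,linorder} network"
  assumes "minimal_irreducible_sorting N"
  shows "(\<forall>z \<in> rel_interior (brick_polytope N).
            simplicial_complex (boundary_complex (polar_about z (brick_polytope N))) \<and>
            simplicially_isomorphic (network_complex N)
              (vertex_scheme (boundary_complex (polar_about z (brick_polytope N))))) \<and>
         ugraph_iso (brick_vector N) (flip_graph N) (polytope_graph (brick_polytope N))"
proof -
  interpret pseudoline_network N
    using assms by unfold_locales (simp add: minimal_irreducible_sorting_def sorting_def)
  interpret flip_system "arr N" "contacts N" upper_line lower_line crossing_of "brick_vector N"
    using assms by (rule flip_system_arr)
  have complex: "network_complex N = \<Delta>" by (simp add: network_complex_def \<Delta>_def)
  have flip_iff: "flip N \<Lambda> M \<longleftrightarrow> (\<exists>v\<in>contacts N \<Lambda>. flips \<Lambda> v M)" if arr: "\<Lambda> \<in> arr N" "M \<in> arr N" for \<Lambda> M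
  proof
    assume "flip N \<Lambda> M"
    then obtain v where v: "M \<noteq> \<Lambda>" "v \<in> contacts N \<Lambda>" "contacts N \<Lambda> - {v} \<subseteq> contacts N M"
      using flip_arr_iff[OF assms arr] by blast
    obtain \<Lambda>' where \<Lambda>': "\<Lambda>' \<in> arr N" "flips \<Lambda> v \<Lambda>'" using flip_exists[OF arr(1) v(2)] .
    have "M = \<Lambda>'" using ridge[OF arr(1) v(2) \<Lambda>'] v arr(2) by blast
    then show "\<exists>v\<in>contacts N \<Lambda>. flips \<Lambda> v M" using v(2) \<Lambda>'(2) by blast
  next
    assume "\<exists>v\<in>contacts N \<Lambda>. flips \<Lambda> v M"
    then obtain v where v: "v \<in> contacts N \<Lambda>" "flips \<Lambda> v M" by blast
    then have "M \<noteq> \<Lambda>" "contacts N \<Lambda> - {v} \<subseteq> contacts N M"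
      using flips_neq flips_keep[OF v(2), of "contacts N \<Lambda> - {v}"] by blast+
    then show "flip N \<Lambda> M" using flip_arr_iff[OF assms arr] v(1) by blast
  qed
  have "(`) (brick_vector N) ` snd (flip_graph N) = snd (polytope_graph P)"
  proof
    show "(`) (brick_vector N) ` snd (flip_graph N) \<subseteq> snd (polytope_graph P)"
    proof
      fix e assume "e \<in> (`) (brick_vector N) ` snd (flip_graph N)"
      then obtain \<Lambda> M where "e = {brick_vector N \<Lambda>, brick_vector N M}" "\<Lambda> \<in> arr N" "M \<in> arr N" "flip N \<Lambda> M"
        by (auto simp: flip_graph_def)
      then show "e \<in> snd (polytope_graph P)"
        using flip_iff[of \<Lambda> M] edge_of_P_iff[of "brick_vector N \<Lambda>" "brick_vector N M"]
        unfolding polytope_graph_def snd_conv by blast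
    qed
    show "snd (polytope_graph P) \<subseteq> (`) (brick_vector N) ` snd (flip_graph N)"
    proof
      fix e assume "e \<in> snd (polytope_graph P)"
      then obtain \<Lambda> v M where M: "\<Lambda> \<in> arr N" "v \<in> contacts N \<Lambda>" "M \<in> arr N" "flips \<Lambda> v M"
        and e: "e = brick_vector N ` {\<Lambda>, M}"
        unfolding polytope_graph_def snd_conv edge_of_P_iff by auto
      have "{\<Lambda>, M} \<in> snd (flip_graph N)" unfolding flip_graph_def snd_conv using M flip_iff[of \<Lambda> M] by blast
      then show "e \<in> (`) (brick_vector N) ` snd (flip_graph N)" unfolding e by (rule imageI)
    qed
  qed
  moreover have "bij_betw (brick_vector N) (fst (flip_graph N)) (fst (polytope_graph P))"
    using inj_\<omega> extreme_points_P by (simp add: bij_betw_def flip_graph_def polytope_graph_def)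
  ultimately show ?thesis
    unfolding brick_polytope_def complex ugraph_iso_def
    using simplicial_complex_polar polar_iso by blast
qed

end
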